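(* Let $\Gamma=\mathbb{Z}/b\mathbb{Z}$ with $b\ge 1$, let $n$ and $k$ be positive integers, and let $c\in\Gamma$ and $\lambda_0,\dots,\lambda_n\in\Gamma$ with $\lambda_0$ and $\lambda_n$ invertible. Let $R\subseteq\Gamma^{n+1}$ be the affine relation $$a_0a_1\cdots a_n\in R \iff c=\sum_{i=0}^n\lambda_i a_i,$$ and let $\sigma:\Gamma^n\to\Gamma^n$ be the associated affine succession rule. Let $\Lambda=\sum_{i=0}^n\lambda_iX^{n-i}\in\Gamma[X]$, let $\omega$ be any positive multiple of the order of $X$ modulo $\Lambda$, and let $s$ be the length of the smallest cycle in the factor $F_k(\sigma)$; equivalently, $s$ is the smallest positive multiple of $k$ such that $c(1+X+\cdots+X^{s-1})\in(\Lambda,X^s-1)$. Then the number of cycles in $F_k(\sigma)$ is $$|F_k(\sigma)|=\frac{k\,(s:\omega)}{s\,\omega}\sum_{(s:\omega)\mid d\mid \omega}\varphi(\omega/d)\left|\frac{\Gamma[X]}{(\Lambda,X^d-1)}\right|,$$ where the sum is over all positive integers $d$ with $(s:\omega)\mid d$ and $d\mid\omega$.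
   Context: $(a:b)$ denotes the greatest common divisor of the integers $a,b$; $(P,Q)$ denotes the ideal of $\Gamma[X]$ generated by $P$ and $Q$; $\varphi$ is Euler's totient function. The order of $X$ modulo $\Lambda$ is the multiplicative order of the class of $X$ in the ring $\Gamma[X]/(\Lambda)$ (this class is a unit of a finite ring). The affine succession rule $\sigma$ associated with $R$ sends $a_0a_1\cdots a_{n-1}$ to $a_1\cdots a_{n-1}a_n$, where $a_n$ is the unique element of $\Gamma$ with $a_0a_1\cdots a_n\in R$; since $\lambda_0,\lambda_n$ are invertible, $\sigma$ is a well-defined bijection of $\Gamma^n$. $F_k(\sigma)$ is the set of orbits (cycles) of the bijection $A_k(\sigma):\Gamma^n\times\mathbb{Z}/k\mathbb{Z}\to\Gamma^n\times\mathbb{Z}/k\mathbb{Z}$, $(u,i)\mapsto(\sigma(u),i+1)$. The length of a cycle is its number of elements. *)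

theory Defs
  imports
    "HOL-Algebra.IntRing"
    "HOL-Algebra.UnivPoly"
    "HOL-Algebra.QuotRing"
    "HOL-Algebra.Multiplicative_Group"
    "HOL-Combinatorics.Orbits"
    "HOL-Number_Theory.Totient"
begin

definition words :: "'a set \<Rightarrow> nat \<Rightarrow> 'a list set" where
  "words A n = {u. length u = n \<and> set u \<subseteq> A}"

definition affine_relation ::
  "('a, 'm) ring_scheme \<Rightarrow> nat \<Rightarrow> (nat \<Rightarrow> 'a) \<Rightarrow> 'a \<Rightarrow> 'a list set" where
  "affine_relation G n lam c =
     {a \<in> words (carrier G) (Suc n). c = (\<Oplus>\<^bsub>G\<^esub>i\<in>{0..n}. lam i \<otimes>\<^bsub>G\<^esub> a ! i)}"

text \<open>The rule is only meaningful for relations in which every word of length \<open>n\<close> over \<open>A\<close> has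
  exactly one right extension.\<close>

definition succession_rule :: "'a set \<Rightarrow> 'a list set \<Rightarrow> 'a list \<Rightarrow> 'a list" where
  "succession_rule A R u = tl u @ [THE a. a \<in> A \<and> u @ [a] \<in> R]"

text \<open>The cyclic group of order \<open>k\<close> is represented by \<open>{0..<k}\<close> with addition modulo \<open>k\<close>.\<close>

definition product_rule :: "nat \<Rightarrow> ('w \<Rightarrow> 'w) \<Rightarrow> 'w \<times> nat \<Rightarrow> 'w \<times> nat" where
  "product_rule k \<sigma> = (\<lambda>(u, i). (\<sigma> u, (i + 1) mod k))"

text \<open>The library's \<open>orbit f x\<close> consists of the forward iterates \<open>f x, f (f x), \<dots>\<close>; it is the
  cycle through \<open>x\<close> because the product rule permutes the finite set \<open>W \<times> {0..<k}\<close> whenever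
  \<open>\<sigma>\<close> permutes the finite set \<open>W\<close>.\<close>

definition factor :: "'w set \<Rightarrow> nat \<Rightarrow> ('w \<Rightarrow> 'w) \<Rightarrow> ('w \<times> nat) set set" where
  "factor W k \<sigma> = orbit (product_rule k \<sigma>) ` (W \<times> {0..<k})"

definition X_poly :: "('a, 'm) ring_scheme \<Rightarrow> nat \<Rightarrow> 'a" where
  "X_poly G = monom (UP G) \<one>\<^bsub>G\<^esub> 1"

definition Lambda_poly ::
  "('a, 'm) ring_scheme \<Rightarrow> nat \<Rightarrow> (nat \<Rightarrow> 'a) \<Rightarrow> nat \<Rightarrow> 'a" where
  "Lambda_poly G n lam = (\<Oplus>\<^bsub>UP G\<^esub>i\<in>{0..n}. monom (UP G) (lam i) (n - i))"

definition order_X_mod :: "('a, 'm) ring_scheme \<Rightarrow> (nat \<Rightarrow> 'a) \<Rightarrow> nat" where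
  "order_X_mod G L =
     (let I = Idl\<^bsub>UP G\<^esub> {L}
      in group.ord (units_of (UP G Quot I)) (I +>\<^bsub>UP G\<^esub> X_poly G))"

definition period_ideal ::
  "('a, 'm) ring_scheme \<Rightarrow> (nat \<Rightarrow> 'a) \<Rightarrow> nat \<Rightarrow> (nat \<Rightarrow> 'a) set" where
  "period_ideal G L d =
     Idl\<^bsub>UP G\<^esub> {L, X_poly G [^]\<^bsub>UP G\<^esub> d \<ominus>\<^bsub>UP G\<^esub> \<one>\<^bsub>UP G\<^esub>}"

definition geometric_poly :: "('a, 'm) ring_scheme \<Rightarrow> 'a \<Rightarrow> nat \<Rightarrow> nat \<Rightarrow> 'a" where
  "geometric_poly G c s = c \<odot>\<^bsub>UP G\<^esub> (\<Oplus>\<^bsub>UP G\<^esub>j\<in>{..<s}. X_poly G [^]\<^bsub>UP G\<^esub> j)"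

end

theory Submission
  imports Defs
begin

text \<open>
  A word \<open>u = a\<^sub>0 \<dots> a\<^sub>n\<^sub>-\<^sub>1\<close> starts a unique sequence with \<open>\<Sum>\<^sub>i \<lambda>\<^sub>i a\<^sub>m\<^sub>+\<^sub>i = c\<close> for all \<open>m\<close>. Multiplying
  its generating series by \<open>\<Lambda>\<close> leaves a polynomial \<open>p\<^sub>u\<close> of degree less than \<open>n\<close> plus
  \<open>c X\<^sup>n / (1 - X)\<close>, so a shift of the sequence gives \<open>X p\<^sub>v = p\<^sub>u + c X\<^sup>n - a\<^sub>0 \<Lambda>\<close> for
  \<open>v = \<sigma> u\<close>. Because \<open>\<lambda>\<^sub>n\<close> is invertible, \<open>u \<mapsto> p\<^sub>u\<close> is a triangular bijection onto the
  polynomials of degree less than \<open>n\<close>, and because \<open>\<lambda>\<^sub>0\<close> is invertible these are exactly the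
  residues modulo \<open>\<Lambda>\<close>. Hence \<open>\<sigma>\<close> is conjugate to an affine map of the finite ring
  \<open>Q = \<Gamma>[X]/(\<Lambda>)\<close>: with \<open>\<xi>\<close> the class of \<open>X\<close>, \<open>\<epsilon>\<close> that of \<open>c X\<^sup>n\<close> and \<open>\<theta> u\<close> that of
  \<open>p\<^sub>u\<close>, one has \<open>\<xi> \<theta>(\<sigma> u) = \<theta> u + \<epsilon>\<close> (\<open>proj_numerator_\<sigma>\<close>, \<open>bij_betw_proj_numerator\<close>).

  Iterating, \<open>\<sigma>\<^sup>t u = u\<close> says \<open>(\<xi>\<^sup>t - 1) \<theta> u = \<epsilon> (1 + \<xi> + \<dots> + \<xi>\<^sup>t\<^sup>-\<^sup>1)\<close>. So \<open>\<sigma>\<^sup>t\<close> has a fixed point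
  iff \<open>c (1 + \<dots> + X\<^sup>t\<^sup>-\<^sup>1) \<in> (\<Lambda>, X\<^sup>t - 1)\<close>, as \<open>\<xi>\<close> is a unit, and then the fixed points form a
  coset of the annihilator of \<open>\<xi>\<^sup>t - 1\<close> in \<open>Q\<close>. In a finite ring the annihilator of an element has
  as many elements as the quotient by that element, here \<open>\<Gamma>[X]/(\<Lambda>, X\<^sup>t - 1)\<close>
  (\<open>card_quotient_period_ideal\<close>); it depends on \<open>gcd t \<omega>\<close> only, as \<open>\<xi>\<^sup>\<omega> = 1\<close>.

  The exponents \<open>t\<close> for which \<open>\<sigma>\<^sup>t\<close> has a fixed point are closed under multiples and under gcd;
  those divisible by \<open>k\<close> are therefore the multiples of the least positive one, which is the least
  cycle length \<open>s\<close>. The product rule has order dividing \<open>s \<omega>\<close>, and counting cycles by averaging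
  fixed points over \<open>t < s \<omega>\<close> (\<open>sum_card_fixed_points\<close>) leaves the sum over \<open>t = s j\<close>,
  \<open>j < \<omega>\<close>. Grouping it by the value of \<open>gcd (s j) \<omega>\<close> produces the totients
  (\<open>sum_gcd_multiples_eq_totient_sum\<close>).
\<close>

section \<open>Cycles and fixed points of iterates\<close>

lemma funpow_fixed_iff_card_orbit_dvd:
  assumes "(f ^^ N) x = x" and "0 < N"
  shows "(f ^^ t) x = x \<longleftrightarrow> card (orbit f x) dvd t"
proof -
  define p where "p = (LEAST p. 0 < p \<and> (f ^^ p) x = x)"
  have p: "0 < p" "(f ^^ p) x = x"
    using LeastI [of "\<lambda>p. 0 < p \<and> (f ^^ p) x = x" N] assms by (auto simp: p_def)
  have least: "p \<le> m" if "0 < m" "(f ^^ m) x = x" for m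
    unfolding p_def using that by (intro Least_le) auto
  have fixed_iff: "(f ^^ m) x = x \<longleftrightarrow> p dvd m" for m
  proof
    assume "(f ^^ m) x = x"
    then have "(f ^^ (m mod p)) x = x"
      using p(2) by (simp add: funpow_mod_eq)
    then have "m mod p = 0"
      using least [of "m mod p"] mod_less_divisor [OF p(1), of m] by (cases "m mod p = 0") auto
    then show "p dvd m" by auto
  next
    assume "p dvd m"
    then have "(f ^^ m) x = (f ^^ (m mod p)) x"
      using funpow_mod_eq [OF p(2), of m] by simp
    then show "(f ^^ m) x = x" using \<open>p dvd m\<close> by auto
  qed
  have distinct: "False" if "i < j" "j < p" "(f ^^ i) x = (f ^^ j) x" for i j
  proof -
    have "(f ^^ (p - j + i)) x = (f ^^ (p - j)) ((f ^^ i) x)"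
      by (simp add: funpow_add)
    also have "\<dots> = (f ^^ (p - j + j)) x"
      by (simp only: that(3) funpow_add o_apply)
    also have "\<dots> = x"
      using that p(2) by simp
    finally have "p \<le> p - j + i"
      using that by (intro least) auto
    then show False using that by linarith
  qed
  have "inj_on (\<lambda>m. (f ^^ m) x) {..<p}"
  proof (rule inj_onI)
    fix i j
    assume "i \<in> {..<p}" "j \<in> {..<p}" "(f ^^ i) x = (f ^^ j) x"
    then show "i = j"
      using distinct [of i j] distinct [of j i] by (cases i j rule: linorder_cases) auto
  qed
  moreover have "orbit f x = (\<lambda>m. (f ^^ m) x) ` {..<p}"
    using orbit_altdef_bounded [OF p(2) p(1)] by auto
  ultimately have "card (orbit f x) = p"
    by (simp add: card_image)
  then show ?thesis using fixed_iff by simp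
qed

lemma card_multiples_below:
  assumes "p dvd N" and "0 < N"
  shows "card {t. t < N \<and> p dvd t} = N div (p::nat)"
proof -
  have "bij_betw (\<lambda>j. p * j) {..<N div p} {t. t < N \<and> p dvd t}"
    using assms by (auto simp: bij_betw_def inj_on_def image_iff elim!: dvdE)
  then show ?thesis
    using bij_betw_same_card by fastforce
qed

text \<open>
  Burnside's count for the cyclic group generated by \<open>f\<close>: a point on a cycle of length \<open>l\<close> is fixed
  by \<open>f\<^sup>t\<close> for exactly \<open>N / l\<close> of the exponents \<open>t < N\<close>, so every cycle contributes \<open>N\<close>.
\<close>

lemma sum_card_fixed_points:
  assumes "finite S" and closed: "\<And>x. x \<in> S \<Longrightarrow> f x \<in> S"
    and "0 < N" and period: "\<And>x. x \<in> S \<Longrightarrow> (f ^^ N) x = x"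
  shows "(\<Sum>t<N. card {x \<in> S. (f ^^ t) x = x}) = N * card (orbit f ` S)"
proof -
  have self: "x \<in> orbit f x" if "x \<in> S" for x
    using period [OF that] \<open>0 < N\<close> by (metis (mono_tags, lifting) mem_Collect_eq orbit_altdef)
  have sub: "orbit f x \<subseteq> S" if "x \<in> S" for x
  proof
    fix y assume "y \<in> orbit f x"
    then show "y \<in> S" using that by induct (auto simp: closed)
  qed
  have fibre: "{y \<in> S. orbit f y = orbit f x} = orbit f x" if "x \<in> S" for x
  proof (intro equalityI subsetI)
    fix y assume "y \<in> {y \<in> S. orbit f y = orbit f x}"
    then show "y \<in> orbit f x" using self by auto
  next
    fix y assume y: "y \<in> orbit f x"
    then have "x \<in> orbit f y" using self [OF that] by (rule orbit_swap [rotated])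
    then have "orbit f y = orbit f x" using y by (auto intro: orbit_trans)
    then show "y \<in> {y \<in> S. orbit f y = orbit f x}" using y sub [OF that] by auto
  qed
  have dvdN: "card (orbit f x) dvd N" if "x \<in> S" for x
    using funpow_fixed_iff_card_orbit_dvd [OF period [OF that] \<open>0 < N\<close>, of N] period [OF that] by simp
  have "(\<Sum>t<N. card {x \<in> S. (f ^^ t) x = x}) = (\<Sum>t<N. \<Sum>x\<in>S. if (f ^^ t) x = x then 1 else 0)"
    using \<open>finite S\<close> by (intro sum.cong refl) (simp add: sum.If_cases Int_def)
  also have "\<dots> = (\<Sum>x\<in>S. \<Sum>t<N. if (f ^^ t) x = x then 1 else 0)"
    by (rule sum.swap)
  also have "\<dots> = (\<Sum>x\<in>S. N div card (orbit f x))"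
  proof (rule sum.cong [OF refl])
    fix x assume "x \<in> S"
    have "(\<Sum>t<N. if (f ^^ t) x = x then 1 else 0) = card {t. t < N \<and> card (orbit f x) dvd t}"
      by (simp add: sum.If_cases Int_def
          funpow_fixed_iff_card_orbit_dvd [OF period [OF \<open>x \<in> S\<close>] \<open>0 < N\<close>])
    then show "(\<Sum>t<N. if (f ^^ t) x = x then 1 else 0) = N div card (orbit f x)"
      using card_multiples_below [OF dvdN [OF \<open>x \<in> S\<close>] \<open>0 < N\<close>] by simp
  qed
  also have "\<dots> = (\<Sum>C\<in>orbit f ` S. \<Sum>x\<in>{x \<in> S. orbit f x = C}. N div card (orbit f x))"
    using \<open>finite S\<close> by (rule sum.image_gen)
  also have "\<dots> = (\<Sum>C\<in>orbit f ` S. N)"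
  proof (rule sum.cong [OF refl])
    fix C assume "C \<in> orbit f ` S"
    then obtain y where y: "y \<in> S" "C = orbit f y" by auto
    have "(\<Sum>x\<in>{x \<in> S. orbit f x = C}. N div card (orbit f x))
        = (\<Sum>x\<in>{x \<in> S. orbit f x = C}. N div card C)"
      by (rule sum.cong) auto
    also have "\<dots> = card C * (N div card C)"
      using fibre [OF y(1)] y(2) by simp
    also have "\<dots> = N" using dvdN y by simp
    finally show "(\<Sum>x\<in>{x \<in> S. orbit f x = C}. N div card (orbit f x)) = N" .
  qed
  finally show ?thesis by simp
qed

section \<open>Sums over greatest common divisors\<close>

text \<open>
  Among \<open>1, \<dots>, w\<close> there are \<open>\<phi>(w/e)\<close> numbers whose gcd with \<open>w\<close> is \<open>e\<close>.
\<close>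

lemma sum_gcd_eq_totient_sum:
  fixes H :: "nat \<Rightarrow> nat"
  assumes "0 < w"
  shows "(\<Sum>j<w. H (gcd j w)) = (\<Sum>e | e dvd w. totient (w div e) * H e)"
proof -
  \<comment> \<open>The totient counts over \<open>1, \<dots>, w\<close>, so the index \<open>0\<close> is moved to \<open>w\<close>, which has the same gcd.\<close>
  have "(\<Sum>j<w. H (gcd j w)) = (\<Sum>j\<in>{0<..w}. H (gcd j w))"
    using assms
    by (intro sum.reindex_bij_witness [of _ "\<lambda>j. if j = w then 0 else j" "\<lambda>j. if j = 0 then w else j"])
       auto
  also have "\<dots> = (\<Sum>e | e dvd w. \<Sum>j\<in>{j \<in> {0<..w}. gcd j w = e}. H (gcd j w))"
    using assms by (intro sum.group [symmetric]) auto
  also have "\<dots> = (\<Sum>e | e dvd w. totient (w div e) * H e)"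
  proof (rule sum.cong [OF refl])
    fix e assume e: "e \<in> {e. e dvd w}"
    have "(\<Sum>j\<in>{j \<in> {0<..w}. gcd j w = e}. H (gcd j w)) = (\<Sum>j\<in>{j \<in> {0<..w}. gcd j w = e}. H e)"
      by (rule sum.cong) auto
    then show "(\<Sum>j\<in>{j \<in> {0<..w}. gcd j w = e}. H (gcd j w)) = totient (w div e) * H e"
      using card_gcd_eq_totient [OF assms] e by simp
  qed
  finally show ?thesis .
qed

text \<open>
  With \<open>g = gcd s \<omega>\<close> and \<open>\<omega> = g w\<close> one has \<open>gcd (s j) \<omega> = g \<cdot> gcd j w\<close>, which is periodic in
  \<open>j\<close> with period \<open>w\<close>; the range \<open>j < \<omega>\<close> consists of \<open>g\<close> periods.
\<close>

lemma sum_gcd_multiples_eq_totient_sum: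
  fixes H :: "nat \<Rightarrow> nat"
  assumes "0 < \<omega>"
  shows "(\<Sum>j<\<omega>. H (gcd (s * j) \<omega>))
    = gcd s \<omega> * (\<Sum>d | 0 < d \<and> gcd s \<omega> dvd d \<and> d dvd \<omega>. totient (\<omega> div d) * H d)"
proof -
  define g where "g = gcd s \<omega>"
  obtain s' w where s: "s = g * s'" and \<omega>: "\<omega> = g * w" and "coprime s' w"
    using assms by (metis g_def gcd_coprime_exists gcd_eq_0_iff less_not_refl mult.commute)
  have "0 < g" "0 < w" using assms \<omega> by auto
  have gcd_eq: "gcd (s * j) \<omega> = g * gcd j w" for j
    using \<open>coprime s' w\<close> by (simp add: s \<omega> mult.assoc gcd_mult_left coprime_commute
        gcd_mult_left_left_cancel flip: gcd_mult_distrib_nat)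
  have "(\<Sum>j<\<omega>. H (gcd (s * j) \<omega>)) = (\<Sum>j<g * w. H (g * gcd j w))"
    by (simp add: gcd_eq \<omega> [symmetric])
  also have "\<dots> = (\<Sum>m<g. \<Sum>j\<in>{m * w..<m * w + w}. H (g * gcd j w))"
    by (rule sum.nat_group [symmetric])
  also have "\<dots> = (\<Sum>m<g. \<Sum>j<w. H (g * gcd j w))"
  proof (rule sum.cong [OF refl])
    fix m
    show "(\<Sum>j\<in>{m * w..<m * w + w}. H (g * gcd j w)) = (\<Sum>j<w. H (g * gcd j w))"
      by (rule sum.reindex_bij_witness [of _ "\<lambda>j. j + m * w" "\<lambda>j. j - m * w"])
         (auto simp: gcd_diff1_nat, metis add.commute gcd_add_mult le_add_diff_inverse2 gcd.commute mult.commute)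
  qed
  also have "\<dots> = g * (\<Sum>e | e dvd w. totient (w div e) * H (g * e))"
    using sum_gcd_eq_totient_sum [OF \<open>0 < w\<close>, of "\<lambda>e. H (g * e)"] by simp
  also have "(\<Sum>e | e dvd w. totient (w div e) * H (g * e))
      = (\<Sum>d | 0 < d \<and> g dvd d \<and> d dvd \<omega>. totient (\<omega> div d) * H d)"
    using \<open>0 < g\<close> \<open>0 < w\<close> unfolding \<omega>
    by (intro sum.reindex_bij_witness [of _ "\<lambda>d. d div g" "\<lambda>e. g * e"])
       (auto simp: dvd_div_iff_mult mult.commute intro: dvd_pos_nat)
  finally show ?thesis unfolding g_def .
qed

section \<open>Affine maps of a finite commutative ring\<close>

text \<open>
  A map \<open>\<sigma>\<close> conjugate, through \<open>\<theta>\<close>, to \<open>q \<mapsto> x\<inverse> (q + e)\<close> on a finite commutative ring,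
  where \<open>x\<close> is a unit because \<open>x\<^sup>\<omega> = 1\<close>.
\<close>

locale affine_rotation = Q?: cring Q for Q (structure) +
  fixes W :: "'w set" and \<sigma> :: "'w \<Rightarrow> 'w" and \<theta> :: "'w \<Rightarrow> 'a" and x e :: 'a and \<omega> :: nat
  assumes finite_Q: "finite (carrier Q)"
    and x_closed [simp]: "x \<in> carrier Q"
    and e_closed [simp]: "e \<in> carrier Q"
    and \<omega>_pos: "0 < \<omega>"
    and x_pow_\<omega>: "x [^] \<omega> = \<one>"
    and \<theta>_bij: "bij_betw \<theta> W (carrier Q)"
    and \<sigma>_closed: "\<And>u. u \<in> W \<Longrightarrow> \<sigma> u \<in> W"
    and \<theta>_\<sigma>: "\<And>u. u \<in> W \<Longrightarrow> x \<otimes> \<theta> (\<sigma> u) = \<theta> u \<oplus> e"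
begin

definition geom :: "nat \<Rightarrow> 'a" where
  "geom t = (\<Oplus>j\<in>{..<t}. x [^] j)"

text \<open>
  The exponents \<open>t\<close> for which \<open>\<sigma>\<^sup>t\<close> has a fixed point, expressed in the ring.
\<close>

definition admissible :: "nat \<Rightarrow> bool" where
  "admissible t \<longleftrightarrow> (\<exists>r \<in> carrier Q. e \<otimes> geom t = (x [^] t \<ominus> \<one>) \<otimes> r)"

definition invariants :: "nat \<Rightarrow> 'a set" where
  "invariants t = {q \<in> carrier Q. x [^] t \<otimes> q = q}"

lemma geom_closed [simp]: "geom t \<in> carrier Q"
  by (simp add: geom_def)

lemma geom_0 [simp]: "geom 0 = \<zero>"
  by (simp add: geom_def)

lemma geom_Suc: "geom (Suc t) = geom t \<oplus> x [^] t"
  by (simp add: geom_def lessThan_Suc a_comm)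

lemma geom_add: "geom (m + n) = geom m \<oplus> x [^] m \<otimes> geom n"
  by (induction n) (simp_all add: geom_Suc r_distr a_assoc nat_pow_mult)

lemma \<theta>_closed [simp]: "u \<in> W \<Longrightarrow> \<theta> u \<in> carrier Q"
  using \<theta>_bij by (auto simp: bij_betw_def)

lemma \<sigma>_pow_closed: "u \<in> W \<Longrightarrow> (\<sigma> ^^ t) u \<in> W"
  by (induction t) (auto intro: \<sigma>_closed)

lemma finite_W: "finite W"
  using \<theta>_bij finite_Q bij_betw_finite by blast

lemma x_Unit: "x \<in> Units Q"
proof -
  have "x \<otimes> x [^] (\<omega> - 1) = \<one>"
    using \<omega>_pos x_pow_\<omega> by (metis Suc_diff_1 nat_pow_Suc2 x_closed)
  then show ?thesis
    unfolding Units_def using m_comm [OF x_closed nat_pow_closed [OF x_closed, of "\<omega> - 1"]] by auto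
qed

lemma x_pow_cancel:
  assumes "p \<in> carrier Q" "q \<in> carrier Q"
  shows "x [^] (t::nat) \<otimes> p = x [^] t \<otimes> q \<longleftrightarrow> p = q"
  using assms x_Unit by (simp add: Units_pow_closed)

lemma x_pow_mult_\<omega>: "x [^] (\<omega> * b) = \<one>"
  by (simp add: x_pow_\<omega> flip: nat_pow_pow)

lemma \<theta>_\<sigma>_pow:
  assumes "u \<in> W"
  shows "x [^] t \<otimes> \<theta> ((\<sigma> ^^ t) u) = \<theta> u \<oplus> e \<otimes> geom t"
proof (induction t)
  case 0
  then show ?case using assms by simp
next
  case (Suc t)
  have W: "(\<sigma> ^^ t) u \<in> W" "\<sigma> ((\<sigma> ^^ t) u) \<in> W"
    using assms \<sigma>_pow_closed [of u t] \<sigma>_closed by auto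
  have "x [^] Suc t \<otimes> \<theta> ((\<sigma> ^^ Suc t) u) = x [^] t \<otimes> (x \<otimes> \<theta> (\<sigma> ((\<sigma> ^^ t) u)))"
    using W by (simp add: m_assoc)
  also have "\<dots> = x [^] t \<otimes> \<theta> ((\<sigma> ^^ t) u) \<oplus> e \<otimes> x [^] t"
    using W by (simp add: \<theta>_\<sigma> r_distr m_comm)
  also have "\<dots> = \<theta> u \<oplus> e \<otimes> geom (Suc t)"
    using assms by (simp add: Suc.IH geom_Suc r_distr a_assoc)
  finally show ?case .
qed

lemma \<sigma>_pow_fixed_iff:
  assumes "u \<in> W"
  shows "(\<sigma> ^^ t) u = u \<longleftrightarrow> x [^] t \<otimes> \<theta> u = \<theta> u \<oplus> e \<otimes> geom t"
proof -
  have "(\<sigma> ^^ t) u = u \<longleftrightarrow> \<theta> ((\<sigma> ^^ t) u) = \<theta> u"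
    using \<theta>_bij assms \<sigma>_pow_closed [OF assms] by (auto simp: bij_betw_def inj_on_def)
  also have "\<dots> \<longleftrightarrow> x [^] t \<otimes> \<theta> ((\<sigma> ^^ t) u) = x [^] t \<otimes> \<theta> u"
    using assms \<sigma>_pow_closed by (simp add: x_pow_cancel)
  finally show ?thesis
    using \<theta>_\<sigma>_pow [OF assms, of t] by auto
qed

lemma affine_equation_iff:
  assumes "q \<in> carrier Q" "a \<in> carrier Q" "y \<in> carrier Q"
  shows "y \<otimes> q = q \<oplus> a \<longleftrightarrow> a = (y \<ominus> \<one>) \<otimes> q"
proof
  assume "y \<otimes> q = q \<oplus> a"
  moreover have "(y \<ominus> \<one>) \<otimes> q = y \<otimes> q \<ominus> q"
    using assms by algebra
  ultimately have "(y \<ominus> \<one>) \<otimes> q = (q \<oplus> a) \<ominus> q" by simp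
  also have "\<dots> = a" using assms by algebra
  finally show "a = (y \<ominus> \<one>) \<otimes> q" by simp
next
  assume "a = (y \<ominus> \<one>) \<otimes> q"
  then show "y \<otimes> q = q \<oplus> a" using assms(1,3) by algebra
qed

lemma ex_fixed_iff_admissible:
  "(\<exists>u \<in> W. (\<sigma> ^^ t) u = u) \<longleftrightarrow> admissible t"
proof -
  have "(\<exists>u \<in> W. (\<sigma> ^^ t) u = u) \<longleftrightarrow> (\<exists>u \<in> W. e \<otimes> geom t = (x [^] t \<ominus> \<one>) \<otimes> \<theta> u)"
    by (intro bex_cong refl) (simp add: \<sigma>_pow_fixed_iff affine_equation_iff)
  also have "\<dots> \<longleftrightarrow> (\<exists>r \<in> \<theta> ` W. e \<otimes> geom t = (x [^] t \<ominus> \<one>) \<otimes> r)"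
    by blast
  also have "\<theta> ` W = carrier Q"
    using \<theta>_bij by (simp add: bij_betw_def)
  finally show ?thesis
    by (simp only: admissible_def)
qed

text \<open>
  The fixed points of \<open>\<sigma>\<^sup>t\<close> correspond to the solutions of an inhomogeneous linear equation, a
  translate of the solutions of the homogeneous one.
\<close>

lemma card_fixed_eq_card_invariants:
  assumes "admissible t"
  shows "card {u \<in> W. (\<sigma> ^^ t) u = u} = card (invariants t)"
proof -
  obtain r where r: "r \<in> carrier Q" "x [^] t \<otimes> r = r \<oplus> e \<otimes> geom t"
    using assms by (auto simp: admissible_def affine_equation_iff)
  define Fix where "Fix = {u \<in> W. (\<sigma> ^^ t) u = u}"
  define Sol where "Sol = {q \<in> carrier Q. x [^] t \<otimes> q = q \<oplus> e \<otimes> geom t}"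
  have "inj_on \<theta> Fix"
    using \<theta>_bij by (auto simp: bij_betw_def Fix_def intro: inj_on_subset)
  moreover have "\<theta> ` Fix = Sol"
  proof -
    have "\<theta> ` Fix = {q \<in> \<theta> ` W. x [^] t \<otimes> q = q \<oplus> e \<otimes> geom t}"
      by (auto simp: Fix_def \<sigma>_pow_fixed_iff)
    then show ?thesis
      using \<theta>_bij by (simp add: bij_betw_def Sol_def)
  qed
  ultimately have "card Fix = card Sol"
    using card_image by fastforce
  also have "Sol = (\<lambda>q. r \<oplus> q) ` invariants t"
  proof (intro equalityI subsetI)
    fix q assume q: "q \<in> Sol"
    then have "q \<in> carrier Q" "x [^] t \<otimes> q = q \<oplus> e \<otimes> geom t" by (auto simp: Sol_def)
    have "x [^] t \<otimes> (q \<ominus> r) = x [^] t \<otimes> q \<ominus> x [^] t \<otimes> r"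
      using \<open>q \<in> carrier Q\<close> r(1) nat_pow_closed [OF x_closed, of t] by algebra
    also have "\<dots> = (q \<oplus> e \<otimes> geom t) \<ominus> (r \<oplus> e \<otimes> geom t)"
      using r q by (simp add: Sol_def)
    also have "\<dots> = q \<ominus> r"
      using \<open>q \<in> carrier Q\<close> r(1) m_closed [OF e_closed geom_closed [of t]] by algebra
    finally have "q \<ominus> r \<in> invariants t"
      using \<open>q \<in> carrier Q\<close> r(1) by (simp add: invariants_def)
    moreover have "q = r \<oplus> (q \<ominus> r)"
      using \<open>q \<in> carrier Q\<close> r(1) by algebra
    ultimately show "q \<in> (\<lambda>q. r \<oplus> q) ` invariants t" by blast
  next
    fix p assume "p \<in> (\<lambda>q. r \<oplus> q) ` invariants t"
    then obtain q where q: "p = r \<oplus> q" "q \<in> carrier Q" "x [^] t \<otimes> q = q"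
      by (auto simp: invariants_def)
    have "x [^] t \<otimes> p = (r \<oplus> e \<otimes> geom t) \<oplus> q"
      using q r by (simp add: r_distr)
    also have "\<dots> = p \<oplus> e \<otimes> geom t"
      using q(1,2) r(1) m_closed [OF e_closed geom_closed [of t]] by algebra
    finally show "p \<in> Sol" using q r(1) by (simp add: Sol_def)
  qed
  also have "card \<dots> = card (invariants t)"
    using r(1) by (intro card_image) (auto simp: inj_on_def invariants_def)
  finally show ?thesis by (simp add: Fix_def)
qed

lemma pow_minus_one_dvd:
  "\<exists>r \<in> carrier Q. x [^] (g * a) \<ominus> \<one> = (x [^] (g::nat) \<ominus> \<one>) \<otimes> r"
proof (induction a)
  case 0
  show ?case by (rule bexI [of _ \<zero>]) (simp_all add: a_minus_def r_neg)
next
  case (Suc a)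
  then obtain r where r: "r \<in> carrier Q" "x [^] (g * a) \<ominus> \<one> = (x [^] g \<ominus> \<one>) \<otimes> r" by blast
  have "x [^] (g * Suc a) = x [^] g \<otimes> x [^] (g * a)"
    by (simp add: nat_pow_mult)
  then have "x [^] (g * Suc a) \<ominus> \<one> = (x [^] (g * a) \<ominus> \<one>) \<otimes> x [^] g \<oplus> (x [^] g \<ominus> \<one>)"
    using nat_pow_closed [OF x_closed, of g] nat_pow_closed [OF x_closed, of "g * a"] by algebra
  also have "\<dots> = (x [^] g \<ominus> \<one>) \<otimes> (r \<otimes> x [^] g \<oplus> \<one>)"
    unfolding r(2) using r(1) nat_pow_closed [OF x_closed, of g] by algebra
  finally show ?case using r(1) by (intro bexI [of _ "r \<otimes> x [^] g \<oplus> \<one>"]) auto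
qed

lemma admissible_mult:
  assumes "admissible t"
  shows "admissible (t * a)"
proof -
  obtain u where u: "u \<in> W" "(\<sigma> ^^ t) u = u"
    using assms ex_fixed_iff_admissible by blast
  have "((\<sigma> ^^ t) ^^ a) u = u" by (induction a) (simp_all add: u)
  then show ?thesis
    using u(1) ex_fixed_iff_admissible [of "t * a"] by (auto simp: funpow_mult)
qed

text \<open>
  If \<open>t a = t' b + g\<close> with \<open>g = gcd t t'\<close>, then \<open>geom g = geom (t a) - x\<^sup>g geom (t' b)\<close>. After
  multiplication by \<open>e\<close> both terms are multiples of \<open>x\<^sup>m - 1\<close> for some multiple \<open>m\<close> of \<open>g\<close>, hence
  multiples of \<open>x\<^sup>g - 1\<close>.
\<close>

lemma admissible_gcd:
  assumes "admissible t" "admissible t'" "t \<noteq> 0"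
  shows "admissible (gcd t t')"
proof -
  define g where "g = gcd t t'"
  obtain a b where ab: "t * a = t' * b + g"
    using bezout_nat [OF \<open>t \<noteq> 0\<close>, of t'] by (auto simp: g_def)
  have multiple: "\<exists>r \<in> carrier Q. e \<otimes> geom m = (x [^] g \<ominus> \<one>) \<otimes> r"
    if "admissible m" "g dvd m" for m
  proof -
    obtain j where j: "m = g * j" using \<open>g dvd m\<close> by blast
    obtain r where "r \<in> carrier Q" "e \<otimes> geom m = (x [^] m \<ominus> \<one>) \<otimes> r"
      using \<open>admissible m\<close> by (auto simp: admissible_def)
    moreover obtain r' where "r' \<in> carrier Q" "x [^] m \<ominus> \<one> = (x [^] g \<ominus> \<one>) \<otimes> r'"
      using pow_minus_one_dvd [of g j] j by auto
    ultimately show ?thesis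
      by (intro bexI [of _ "r' \<otimes> r"]) (auto simp: m_assoc)
  qed
  obtain p q where pq: "p \<in> carrier Q" "q \<in> carrier Q"
    "e \<otimes> geom (t * a) = (x [^] g \<ominus> \<one>) \<otimes> p" "e \<otimes> geom (t' * b) = (x [^] g \<ominus> \<one>) \<otimes> q"
    using multiple [OF admissible_mult [OF assms(1), of a]]
      multiple [OF admissible_mult [OF assms(2), of b]] by (auto simp: g_def)
  have "geom (t * a) = geom g \<oplus> x [^] g \<otimes> geom (t' * b)"
    using geom_add [of g "t' * b"] by (simp add: ab add.commute)
  then have "e \<otimes> geom (t * a) = e \<otimes> geom g \<oplus> x [^] g \<otimes> (e \<otimes> geom (t' * b))"
    by (simp add: r_distr m_lcomm)
  then have "(x [^] g \<ominus> \<one>) \<otimes> p = e \<otimes> geom g \<oplus> x [^] g \<otimes> ((x [^] g \<ominus> \<one>) \<otimes> q)"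
    by (simp add: pq)
  then have "e \<otimes> geom g = (x [^] g \<ominus> \<one>) \<otimes> p \<ominus> x [^] g \<otimes> ((x [^] g \<ominus> \<one>) \<otimes> q)"
    using pq(1,2) m_closed [OF e_closed geom_closed [of g]] nat_pow_closed [OF x_closed, of g]
    by algebra
  also have "\<dots> = (x [^] g \<ominus> \<one>) \<otimes> (p \<ominus> x [^] g \<otimes> q)"
    using pq(1,2) nat_pow_closed [OF x_closed, of g] by algebra
  finally show ?thesis
    unfolding admissible_def g_def [symmetric]
    using pq(1,2) by (intro bexI [of _ "p \<ominus> x [^] g \<otimes> q"]) auto
qed

lemma x_pow_mult_fixes:
  assumes "q \<in> carrier Q" "x [^] (t::nat) \<otimes> q = q"
  shows "x [^] (t * a) \<otimes> q = q"
  by (induction a) (use assms in \<open>simp_all add: m_assoc flip: nat_pow_mult\<close>)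

text \<open>
  Being fixed by \<open>x\<^sup>t\<close> means being fixed by the subgroup that \<open>x\<^sup>t\<close> generates, and as \<open>x\<^sup>\<omega> = 1\<close> that
  subgroup contains \<open>x\<close> to the power \<open>gcd t \<omega>\<close>.
\<close>

lemma invariants_gcd: "invariants t = invariants (gcd t \<omega>)"
proof (cases "t = 0")
  case True
  then show ?thesis by (simp add: invariants_def x_pow_\<omega>)
next
  case False
  define g where "g = gcd t \<omega>"
  obtain a b where ab: "t * a = \<omega> * b + g"
    using bezout_nat [OF False, of \<omega>] by (auto simp: g_def)
  obtain j where j: "t = g * j" by (metis dvdE g_def gcd_dvd1)
  have "x [^] (t * a) = x [^] g"
    by (simp add: ab x_pow_mult_\<omega> flip: nat_pow_mult)
  then show ?thesis
    unfolding invariants_def g_def [symmetric]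
    using x_pow_mult_fixes [of _ t a] x_pow_mult_fixes [of _ g j] j by auto
qed

lemma W_nonempty: "W \<noteq> {}"
  using \<theta>_bij zero_closed by (auto simp: bij_betw_def)

text \<open>
  Pigeonhole on the iterates \<open>\<sigma>\<^sup>k\<^sup>i u\<close> of a single word.
\<close>

lemma ex_admissible_multiple:
  assumes "0 < (k::nat)"
  shows "\<exists>t > 0. k dvd t \<and> admissible t"
proof -
  obtain u where u: "u \<in> W" using W_nonempty by blast
  have "(\<lambda>i. (\<sigma> ^^ (k * i)) u) ` UNIV \<subseteq> W"
    using u \<sigma>_pow_closed by auto
  then have "\<not> inj (\<lambda>i. (\<sigma> ^^ (k * i)) u)"
    using finite_W by (meson finite_imageD finite_subset infinite_UNIV_nat)
  then obtain i j where "i \<noteq> j" "(\<sigma> ^^ (k * i)) u = (\<sigma> ^^ (k * j)) u"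
    by (auto simp: inj_on_def)
  then obtain i j where ij: "i < j" "(\<sigma> ^^ (k * i)) u = (\<sigma> ^^ (k * j)) u"
    by (metis linorder_neqE_nat)
  have "k * j = k * (j - i) + k * i"
    using ij(1) by (simp flip: distrib_left)
  then have "(\<sigma> ^^ (k * (j - i))) ((\<sigma> ^^ (k * i)) u) = (\<sigma> ^^ (k * i)) u"
    using ij(2) by (simp add: funpow_add)
  then have "admissible (k * (j - i))"
    using \<sigma>_pow_closed [OF u] ex_fixed_iff_admissible by blast
  then show ?thesis
    using assms ij(1) by (intro exI [of _ "k * (j - i)"]) auto
qed

lemma product_rule_pow:
  assumes "i < k"
  shows "(product_rule k \<sigma> ^^ t) (u, i) = ((\<sigma> ^^ t) u, (i + t) mod k)"
  by (induction t) (use assms in \<open>auto simp: product_rule_def mod_Suc_eq\<close>)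

lemma product_rule_pow_fixed_iff:
  assumes "i < k"
  shows "(product_rule k \<sigma> ^^ t) (u, i) = (u, i) \<longleftrightarrow> (\<sigma> ^^ t) u = u \<and> k dvd t"
proof -
  have "(i + t) mod k = i \<longleftrightarrow> (i + t) mod k = (i + 0) mod k"
    using assms by simp
  also have "\<dots> \<longleftrightarrow> k dvd t"
    by (metis add_diff_cancel_left' dvd_eq_mod_eq_0 le_add1 mod_eq_dvd_iff_nat nat_arith.rule0)
  finally show ?thesis using assms by (auto simp: product_rule_pow)
qed

lemma card_product_rule_fixed:
  "card {y \<in> W \<times> {0..<k}. (product_rule k \<sigma> ^^ t) y = y}
   = (if k dvd t then k * card {u \<in> W. (\<sigma> ^^ t) u = u} else 0)"
proof -
  have "{y \<in> W \<times> {0..<k}. (product_rule k \<sigma> ^^ t) y = y}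
      = (if k dvd t then {u \<in> W. (\<sigma> ^^ t) u = u} \<times> {0..<k} else {})"
    using product_rule_pow_fixed_iff by auto
  then show ?thesis by (simp add: card_cartesian_product)
qed

text \<open>
  The admissible multiples of \<open>k\<close> are the multiples of the least positive one, \<open>m\<close>. A cycle of the
  product rule has an admissible length divisible by \<open>k\<close>, and a fixed point of \<open>\<sigma>\<^sup>m\<close> lies on a cycle
  of length exactly \<open>m\<close>, so \<open>m\<close> is the least cycle length.
\<close>

theorem card_factor:
  assumes "0 < k" and "s = Min (card ` factor W k \<sigma>)"
  shows "0 < s" and "k dvd s" and "admissible s"
    and "\<And>t. \<lbrakk>0 < t; k dvd t; admissible t\<rbrakk> \<Longrightarrow> s \<le> t"
    and "s * \<omega> * card (factor W k \<sigma>)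
       = k * gcd s \<omega> * (\<Sum>d | 0 < d \<and> gcd s \<omega> dvd d \<and> d dvd \<omega>. totient (\<omega> div d) * card (invariants d))"
proof -
  define m where "m = (LEAST t. 0 < t \<and> k dvd t \<and> admissible t)"
  have m: "0 < m" "k dvd m" "admissible m"
    using LeastI_ex [OF ex_admissible_multiple [OF \<open>0 < k\<close>]] by (auto simp: m_def)
  have m_least: "m \<le> t" if "0 < t" "k dvd t" "admissible t" for t
    unfolding m_def using that by (intro Least_le) auto
  have admissible_iff: "k dvd t \<and> admissible t \<longleftrightarrow> m dvd t" for t
  proof
    assume "k dvd t \<and> admissible t"
    then have "m \<le> gcd m t"
      using m by (intro m_least admissible_gcd) auto
    then show "m dvd t"
      using m(1) by (metis gcd_dvd1 gcd_dvd2 dvd_imp_le le_antisym)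
  next
    assume "m dvd t"
    then show "k dvd t \<and> admissible t"
      using m admissible_mult by (auto elim!: dvdE)
  qed
  define f where "f = product_rule k \<sigma>"
  define S where "S = W \<times> {0..<k}"
  define N where "N = m * \<omega>"
  have "finite S" using finite_W by (simp add: S_def)
  have "S \<noteq> {}" using W_nonempty \<open>0 < k\<close> by (simp add: S_def)
  have "0 < N" using m(1) \<omega>_pos by (simp add: N_def)
  have F: "factor W k \<sigma> = orbit f ` S" by (simp add: factor_def f_def S_def)
  have f_closed: "f y \<in> S" if "y \<in> S" for y
    using that \<open>0 < k\<close> by (auto simp: S_def f_def product_rule_def \<sigma>_closed)
  have fixed: "card {u \<in> W. (\<sigma> ^^ t) u = u} = card (invariants (gcd t \<omega>))" if "m dvd t" for t
    using that admissible_iff [of t] card_fixed_eq_card_invariants [of t] invariants_gcd [of t] by simp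
  \<comment> \<open>Multiplication by \<open>x\<^sup>N = 1\<close> fixes all of the ring; as \<open>N\<close> is admissible,
    counting shows that \<open>\<sigma>\<^sup>N\<close> is the identity on \<open>W\<close>.\<close>
  have "card {u \<in> W. (\<sigma> ^^ N) u = u} = card (invariants N)"
    using fixed [of N] invariants_gcd [of N] by (simp add: N_def)
  also have "invariants N = carrier Q"
    by (auto simp: invariants_def N_def mult.commute [of m] x_pow_mult_\<omega>)
  also have "card (carrier Q) = card W"
    using \<theta>_bij bij_betw_same_card by metis
  finally have "{u \<in> W. (\<sigma> ^^ N) u = u} = W"
    using finite_W by (intro card_subset_eq) auto
  then have f_N: "(f ^^ N) y = y" if "y \<in> S" for y
    using that product_rule_pow_fixed_iff [of "snd y" k N "fst y"] m(2)
    by (auto simp: S_def f_def N_def)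
  have orbit_dvd: "(f ^^ t) y = y \<longleftrightarrow> card (orbit f y) dvd t" if "y \<in> S" for y t
    using funpow_fixed_iff_card_orbit_dvd [OF f_N [OF that] \<open>0 < N\<close>] .
  have m_dvd: "m dvd card (orbit f y)" if y: "y \<in> S" for y
  proof -
    obtain u i where ui: "y = (u, i)" "u \<in> W" "i < k"
      using y by (auto simp: S_def)
    have "(f ^^ card (orbit f y)) y = y" using orbit_dvd [OF y] by simp
    then have "(\<sigma> ^^ card (orbit f y)) u = u" "k dvd card (orbit f y)"
      using product_rule_pow_fixed_iff [OF ui(3)] by (simp_all add: f_def ui(1))
    then show ?thesis
      using ui(2) ex_fixed_iff_admissible admissible_iff by blast
  qed
  have orbit_pos: "0 < card (orbit f y)" if "y \<in> S" for y
    using orbit_dvd [OF that, of N] f_N [OF that] \<open>0 < N\<close> by (auto intro: dvd_pos_nat)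
  obtain u where u: "u \<in> W" "(\<sigma> ^^ m) u = u"
    using m(3) ex_fixed_iff_admissible by blast
  have u0: "(u, 0) \<in> S" using u(1) \<open>0 < k\<close> by (simp add: S_def)
  have "card (orbit f (u, 0)) dvd m"
    using orbit_dvd [OF u0, of m] product_rule_pow_fixed_iff [of 0 k m u] u m(2) \<open>0 < k\<close>
    by (simp add: f_def)
  then have "card (orbit f (u, 0)) = m"
    using m_dvd [OF u0] by (rule dvd_antisym)
  then have "m \<in> card ` factor W k \<sigma>"
    using u0 by (auto simp: F)
  moreover have "m \<le> c" if "c \<in> card ` factor W k \<sigma>" for c
    using that m_dvd orbit_pos by (auto simp: F intro: dvd_imp_le)
  ultimately have "s = m"
    unfolding assms(2) using \<open>finite S\<close> by (intro Min_eqI) (auto simp: F)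
  then show "0 < s" "k dvd s" "admissible s"
    and "\<And>t. \<lbrakk>0 < t; k dvd t; admissible t\<rbrakk> \<Longrightarrow> s \<le> t"
    using m m_least by auto
  define K where "K d = card (invariants d)" for d
  have "N * card (factor W k \<sigma>) = (\<Sum>t<N. card {y \<in> S. (f ^^ t) y = y})"
    unfolding F using sum_card_fixed_points [OF \<open>finite S\<close> f_closed \<open>0 < N\<close> f_N] by simp
  also have "\<dots> = (\<Sum>t<N. if m dvd t then k * K (gcd t \<omega>) else 0)"
  proof (rule sum.cong [OF refl])
    fix t
    have "card {u \<in> W. (\<sigma> ^^ t) u = u} = 0" if "\<not> admissible t"
      using that ex_fixed_iff_admissible [of t] by (metis (mono_tags, lifting) card.empty empty_Collect_eq)
    then show "card {y \<in> S. (f ^^ t) y = y} = (if m dvd t then k * K (gcd t \<omega>) else 0)"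
      using card_product_rule_fixed [of k t] admissible_iff [of t] fixed [of t]
      by (auto simp: S_def f_def K_def)
  qed
  also have "\<dots> = (\<Sum>t | t < N \<and> m dvd t. k * K (gcd t \<omega>))"
    by (simp add: sum.If_cases Int_def)
  also have "\<dots> = (\<Sum>j<\<omega>. k * K (gcd (m * j) \<omega>))"
    using m(1) unfolding N_def
    by (intro sum.reindex_bij_witness [of _ "\<lambda>j. m * j" "\<lambda>t. t div m"]) auto
  also have "\<dots> = k * gcd m \<omega> * (\<Sum>d | 0 < d \<and> gcd m \<omega> dvd d \<and> d dvd \<omega>. totient (\<omega> div d) * K d)"
    using sum_gcd_multiples_eq_totient_sum [OF \<omega>_pos, of K m]
    by (simp add: mult.assoc flip: sum_distrib_left)
  finally show "s * \<omega> * card (factor W k \<sigma>)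
    = k * gcd s \<omega> * (\<Sum>d | 0 < d \<and> gcd s \<omega> dvd d \<and> d dvd \<omega>. totient (\<omega> div d) * card (invariants d))"
    by (simp add: N_def K_def \<open>s = m\<close>)
qed

end

section \<open>Principal quotients of a finite ring\<close>

lemma card_image_eqI:
  assumes "\<And>a b. \<lbrakk>a \<in> A; b \<in> A\<rbrakk> \<Longrightarrow> f a = f b \<longleftrightarrow> g a = g b"
  shows "card (f ` A) = card (g ` A)"
proof -
  have "bij_betw (\<lambda>y. g (inv_into A f y)) (f ` A) (g ` A)"
    unfolding bij_betw_def
  proof
    have eq: "g (inv_into A f (f a)) = g a" if "a \<in> A" for a
      using assms [of "inv_into A f (f a)" a] that
      by (metis f_inv_into_f imageI inv_into_into)
    then show "(\<lambda>y. g (inv_into A f y)) ` f ` A = g ` A"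
      by (auto simp: image_image)
    show "inj_on (\<lambda>y. g (inv_into A f y)) (f ` A)"
      using eq assms by (auto simp: inj_on_def)
  qed
  then show ?thesis by (rule bij_betw_same_card)
qed

lemma carrier_quotient: "carrier (R Quot I) = (\<lambda>x. I +>\<^bsub>R\<^esub> x) ` carrier R"
  by (auto simp: FactRing_simps)

text \<open>
  Kernel and cokernel of multiplication by \<open>y\<close> on a finite ring are equally large: the image is the
  ideal generated by \<open>y\<close>, and each of its elements has as many preimages as \<open>0\<close>.
\<close>

lemma (in cring) card_quotient_principal_ideal:
  assumes "finite (carrier R)" and y: "y \<in> carrier R"
  shows "card (carrier (R Quot (PIdl y))) = card {q \<in> carrier R. y \<otimes> q = \<zero>}"
proof -
  define K where "K = {q \<in> carrier R. y \<otimes> q = \<zero>}"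
  have "\<zero> \<in> K" using y by (simp add: K_def)
  have image: "PIdl y = (\<lambda>q. y \<otimes> q) ` carrier R"
    using y by (auto simp: cgenideal_def m_comm)
  have fibre: "card {q \<in> carrier R. y \<otimes> q = z} = card K" if "z \<in> PIdl y" for z
  proof -
    obtain r where r: "r \<in> carrier R" "z = y \<otimes> r"
      using \<open>z \<in> PIdl y\<close> by (auto simp: image)
    have "bij_betw (\<lambda>q. r \<oplus> q) K {q \<in> carrier R. y \<otimes> q = z}"
    proof (rule bij_betwI [where g = "\<lambda>q. q \<ominus> r"])
      show "(\<lambda>q. r \<oplus> q) \<in> K \<rightarrow> {q \<in> carrier R. y \<otimes> q = z}"
        using r y by (auto simp: K_def r_distr)
      show "(\<lambda>q. q \<ominus> r) \<in> {q \<in> carrier R. y \<otimes> q = z} \<rightarrow> K"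
      proof
        fix q assume q: "q \<in> {q \<in> carrier R. y \<otimes> q = z}"
        then have "q \<in> carrier R" by simp
        then have "y \<otimes> (q \<ominus> r) = y \<otimes> q \<ominus> y \<otimes> r" using r(1) y by algebra
        then show "q \<ominus> r \<in> K" using q r y by (simp add: K_def a_minus_def r_neg)
      qed
      show "r \<oplus> q \<ominus> r = q" if "q \<in> K" for q
      proof -
        have "q \<in> carrier R" using that by (simp add: K_def)
        then show ?thesis using r(1) by algebra
      qed
      show "r \<oplus> (q \<ominus> r) = q" if "q \<in> {q \<in> carrier R. y \<otimes> q = z}" for q
      proof -
        have "q \<in> carrier R" using that by simp
        then show ?thesis using r(1) by algebra
      qed
    qed
    then show ?thesis by (simp add: bij_betw_same_card)
  qed
  have "card (carrier R) = (\<Sum>q\<in>carrier R. 1)" by simp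
  also have "\<dots> = (\<Sum>z\<in>PIdl y. \<Sum>q\<in>{q \<in> carrier R. y \<otimes> q = z}. 1)"
    unfolding image using assms(1) by (rule sum.image_gen)
  also have "\<dots> = card (PIdl y) * card K"
    using fibre by simp
  finally have "card (PIdl y) * card K = card (carrier R)" by simp
  moreover have "card (carrier (R Quot (PIdl y))) * card (PIdl y) = card (carrier R)"
  proof -
    have "additive_subgroup (PIdl y) R"
      using cgenideal_ideal [OF y] by (rule ideal.axioms(1))
    then show ?thesis
      using a_lagrange [OF assms(1)] by (simp add: FactRing_def order_def)
  qed
  moreover have "0 < card (PIdl y)"
    using assms(1) cgenideal_self [OF y] by (auto simp: card_gt_0_iff image)
  ultimately show ?thesis
    unfolding K_def by (metis less_not_refl mult.commute mult_left_cancel)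
qed

section \<open>Residues modulo the characteristic polynomial\<close>

locale linear_recurrence = UP_cring R P for R (structure) and P (structure) +
  fixes n :: nat and lam :: "nat \<Rightarrow> 'a" and c :: 'a
  assumes finite_R: "finite (carrier R)"
    and n_pos: "1 \<le> n"
    and c_closed [simp]: "c \<in> carrier R"
    and lam_closed [simp]: "\<And>i. i \<le> n \<Longrightarrow> lam i \<in> carrier R"
    and lam_0_Unit: "lam 0 \<in> Units R"
    and lam_n_Unit: "lam n \<in> Units R"
begin

abbreviation "\<Lambda> \<equiv> Lambda_poly R n lam"

abbreviation "\<sigma> \<equiv> succession_rule (carrier R) (affine_relation R n lam c)"

definition Lambda_ideal :: "(nat \<Rightarrow> 'a) set" where
  "Lambda_ideal = Idl\<^bsub>P\<^esub> {\<Lambda>}"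

definition Q :: "(nat \<Rightarrow> 'a) set ring" where
  "Q = P Quot Lambda_ideal"

definition proj :: "(nat \<Rightarrow> 'a) \<Rightarrow> (nat \<Rightarrow> 'a) set" where
  "proj p = Lambda_ideal +>\<^bsub>P\<^esub> p"

definition trunc :: "(nat \<Rightarrow> 'a) \<Rightarrow> nat \<Rightarrow> 'a" where
  "trunc h = (\<lambda>j. if j < n then h j else \<zero>)"

text \<open>
  The polynomial \<open>p\<^sub>u\<close>: the part of degree less than \<open>n\<close> of \<open>\<Lambda>\<close> times the generating series of a
  sequence starting with \<open>u\<close>. Since \<open>\<Lambda>\<close> has coefficient \<open>lam (n - j)\<close> at \<open>X\<^sup>j\<close>, the index
  \<open>n - j + m\<close> belongs to the product of \<open>X\<^sup>j\<^sup>-\<^sup>m\<close> and \<open>X\<^sup>m\<close>.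
\<close>

definition numerator :: "'a list \<Rightarrow> nat \<Rightarrow> 'a" where
  "numerator u = trunc (\<lambda>j. \<Oplus>m\<in>{..j}. lam (n - j + m) \<otimes> u ! m)"

lemma Lambda_closed [simp]: "\<Lambda> \<in> carrier P"
  unfolding Lambda_poly_def P_def [symmetric] by (rule P.finsum_closed) auto

lemma coeff_Lambda: "coeff P \<Lambda> j = (if j \<le> n then lam (n - j) else \<zero>)"
proof -
  have "coeff P \<Lambda> j = (\<Oplus>i\<in>{0..n}. coeff P (monom P (lam i) (n - i)) j)"
    unfolding Lambda_poly_def P_def [symmetric] by (rule coeff_finsum) auto
  also have "\<dots> = (\<Oplus>i\<in>{0..n}. if n - i = j then lam i else \<zero>)"
    by (rule R.finsum_cong') auto
  also have "\<dots> = (if j \<le> n then lam (n - j) else \<zero>)"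
  proof (cases "j \<le> n")
    case True
    have "(\<Oplus>i\<in>{0..n}. if n - i = j then lam i else \<zero>) = (\<Oplus>i\<in>{0..n}. if n - j = i then lam i else \<zero>)"
      using True by (intro R.finsum_cong') auto
    also have "\<dots> = lam (n - j)"
      by (rule R.finsum_singleton) auto
    finally show ?thesis using True by simp
  next
    case False
    have "(\<Oplus>i\<in>{0..n}. if n - i = j then lam i else \<zero>) = (\<Oplus>i\<in>{0..n}. \<zero>)"
      using False by (intro R.finsum_cong') auto
    then show ?thesis using False by simp
  qed
  finally show ?thesis .
qed

lemma X_closed [simp]: "X_poly R \<in> carrier P"
  unfolding X_poly_def P_def [symmetric] by simp

lemma trunc_closed:
  assumes "\<And>j. j < n \<Longrightarrow> h j \<in> carrier R"
  shows "trunc h \<in> carrier P"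
  using assms by (auto simp: P_def UP_def trunc_def up_def intro!: exI [of _ n])

lemma coeff_trunc:
  assumes "\<And>j. j < n \<Longrightarrow> h j \<in> carrier R"
  shows "coeff P (trunc h) j = (if j < n then h j else \<zero>)"
  using trunc_closed [of h] assms by (simp add: P_def UP_def trunc_def)

lemma Lambda_ideal_ideal: "ideal Lambda_ideal P"
  unfolding Lambda_ideal_def by (rule P.genideal_ideal) simp

sublocale Q: cring Q
  unfolding Q_def by (rule ideal.quotient_is_cring [OF Lambda_ideal_ideal P.is_cring])

sublocale proj: ring_hom_cring P Q proj
  using ideal.rcos_ring_hom_cring [OF Lambda_ideal_ideal P.is_cring]
  by (simp add: Q_def proj_def [abs_def])

lemma carrier_Q: "carrier Q = proj ` carrier P"
  by (simp add: Q_def proj_def carrier_quotient)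

lemma proj_eq_iff:
  assumes "p \<in> carrier P" "q \<in> carrier P"
  shows "proj p = proj q \<longleftrightarrow> p \<ominus>\<^bsub>P\<^esub> q \<in> Lambda_ideal"
  unfolding proj_def using P.quotient_eq_iff_same_a_r_cos [OF Lambda_ideal_ideal assms] by simp

lemma mem_Lambda_ideal: "p \<in> Lambda_ideal \<longleftrightarrow> (\<exists>q \<in> carrier P. p = q \<otimes>\<^bsub>P\<^esub> \<Lambda>)"
  unfolding Lambda_ideal_def P.cgenideal_eq_genideal [OF Lambda_closed, symmetric] cgenideal_def by blast

lemma proj_Lambda [simp]: "proj \<Lambda> = \<zero>\<^bsub>Q\<^esub>"
proof -
  have "\<Lambda> \<in> Lambda_ideal"
    unfolding mem_Lambda_ideal by (rule bexI [of _ "\<one>\<^bsub>P\<^esub>"]) simp_all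
  then have "proj \<Lambda> = proj \<zero>\<^bsub>P\<^esub>"
    by (subst proj_eq_iff) (simp_all add: P.minus_eq)
  then show ?thesis by simp
qed

text \<open>
  Division with remainder: \<open>\<Lambda>\<close> has degree \<open>n\<close> with the invertible leading coefficient \<open>lam 0\<close>, so
  the top coefficient can be cancelled as long as the degree is at least \<open>n\<close>.
\<close>

lemma ex_remainder:
  assumes "p \<in> carrier P"
  shows "\<exists>r \<in> carrier P. (\<forall>j\<ge>n. coeff P r j = \<zero>) \<and> proj r = proj p"
proof -
  have "\<exists>r \<in> carrier P. (\<forall>j\<ge>n. coeff P r j = \<zero>) \<and> proj r = proj p"
    if "p \<in> carrier P" "\<forall>j \<ge> N + n. coeff P p j = \<zero>" for N p
    using that
  proof (induction N arbitrary: p)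
    case 0
    then show ?case by auto
  next
    case (Suc N)
    define a where "a = coeff P p (N + n) \<otimes> inv (lam 0)"
    define t where "t = monom P a N \<otimes>\<^bsub>P\<^esub> \<Lambda>"
    have a: "a \<in> carrier R"
      using Suc.prems(1) lam_0_Unit by (simp add: a_def)
    have t: "t \<in> carrier P" using a by (simp add: t_def)
    have coeff_t: "coeff P t (m + N) = a \<otimes> coeff P \<Lambda> m" for m
      unfolding t_def by (rule coeff_monom_mult) (use a in simp_all)
    have "coeff P (p \<ominus>\<^bsub>P\<^esub> t) j = \<zero>" if "N + n \<le> j" for j
    proof -
      define m where "m = j - N"
      have m: "j = m + N" "n \<le> m" using that by (auto simp: m_def)
      have "coeff P (p \<ominus>\<^bsub>P\<^esub> t) j = coeff P p j \<ominus> coeff P t j"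
        using Suc.prems(1) t by simp
      moreover have "coeff P t j = coeff P p j"
      proof (cases "m = n")
        case True
        then show ?thesis
          using Suc.prems(1) lam_0_Unit
          using coeff_t [of n] by (simp add: m(1) coeff_Lambda a_def R.m_assoc add.commute [of n N])
      next
        case False
        then show ?thesis
          using a m Suc.prems(2) by (simp add: coeff_t coeff_Lambda)
      qed
      ultimately show ?thesis using Suc.prems(1) by (simp add: R.minus_eq R.r_neg)
    qed
    then obtain r where "r \<in> carrier P" "\<forall>j\<ge>n. coeff P r j = \<zero>" "proj r = proj (p \<ominus>\<^bsub>P\<^esub> t)"
      using Suc.IH [of "p \<ominus>\<^bsub>P\<^esub> t"] Suc.prems(1) t by auto
    moreover have "proj (p \<ominus>\<^bsub>P\<^esub> t) = proj p"
      using Suc.prems(1) t a by (simp add: t_def P.minus_eq)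
    ultimately show ?case by auto
  qed
  moreover have "\<forall>j \<ge> Suc (deg R p) + n. coeff P p j = \<zero>"
    using assms by (auto intro: deg_aboveD)
  ultimately show ?thesis using assms by blast
qed

text \<open>
  The leading coefficients of \<open>q\<close> and \<open>\<Lambda>\<close> multiply to a nonzero element because \<open>lam 0\<close> is a unit,
  even when the coefficient ring has zero divisors.
\<close>

lemma multiple_of_Lambda_eq_zero:
  assumes "q \<in> carrier P" and "\<And>j. n \<le> j \<Longrightarrow> coeff P (q \<otimes>\<^bsub>P\<^esub> \<Lambda>) j = \<zero>"
  shows "q = \<zero>\<^bsub>P\<^esub>"
proof (rule ccontr)
  assume "q \<noteq> \<zero>\<^bsub>P\<^esub>"
  define D where "D = deg R q"
  have "coeff P (q \<otimes>\<^bsub>P\<^esub> \<Lambda>) (D + n) = (\<Oplus>i\<in>{..D + n}. coeff P q i \<otimes> coeff P \<Lambda> (D + n - i))"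
    using assms(1) by simp
  also have "\<dots> = (\<Oplus>i\<in>{..D + n}. if D = i then coeff P q i \<otimes> lam 0 else \<zero>)"
  proof (rule R.finsum_cong')
    fix i assume "i \<in> {..D + n}"
    consider "i < D" | "i = D" | "D < i" by linarith
    then show "coeff P q i \<otimes> coeff P \<Lambda> (D + n - i) = (if D = i then coeff P q i \<otimes> lam 0 else \<zero>)"
      using assms(1) by cases (auto simp: coeff_Lambda deg_aboveD D_def)
  qed (use assms(1) in auto)
  also have "\<dots> = coeff P q D \<otimes> lam 0"
    using assms(1) by (intro R.finsum_singleton) auto
  finally have "coeff P q D \<otimes> lam 0 = \<zero>"
    using assms(2) [of "D + n"] by simp
  then have "coeff P q D = \<zero>"
    using assms(1) lam_0_Unit
    by (metis R.Units_inv_closed R.Units_r_inv R.l_null R.m_assoc R.r_one coeff_closed lam_closed le0)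
  then show False
    using lcoeff_nonzero [OF \<open>q \<noteq> \<zero>\<^bsub>P\<^esub>\<close> assms(1)] by (simp add: D_def)
qed

section \<open>Words as residues\<close>

abbreviation "W \<equiv> words (carrier R) n"

lemma nth_closed: "\<lbrakk>u \<in> W; i < n\<rbrakk> \<Longrightarrow> u ! i \<in> carrier R"
  by (auto simp: words_def)

lemma finite_W: "finite W"
  using finite_lists_length_eq [OF finite_R, of n] by (simp add: words_def conj_commute)

lemma numerator_term_closed:
  assumes "u \<in> W" "m \<le> j" "j < n"
  shows "lam (n - j + m) \<otimes> u ! m \<in> carrier R"
  using assms nth_closed [of u m] by simp

lemma numerator_coeff_closed:
  assumes "u \<in> W" "j < n"
  shows "(\<Oplus>m\<in>{..j}. lam (n - j + m) \<otimes> u ! m) \<in> carrier R"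
  using assms numerator_term_closed by (intro R.finsum_closed) auto

lemma numerator_closed [simp]: "u \<in> W \<Longrightarrow> numerator u \<in> carrier P"
  unfolding numerator_def by (intro trunc_closed numerator_coeff_closed)

lemma coeff_numerator:
  assumes "u \<in> W"
  shows "coeff P (numerator u) j = (if j < n then \<Oplus>m\<in>{..j}. lam (n - j + m) \<otimes> u ! m else \<zero>)"
  unfolding numerator_def using assms by (intro coeff_trunc numerator_coeff_closed)

text \<open>
  The coefficient at \<open>X\<^sup>j\<close> involves only \<open>u\<^sub>0, \<dots>, u\<^sub>j\<close>, and \<open>u\<^sub>j\<close> with the invertible factor
  \<open>lam n\<close>: a triangular system.
\<close>

lemma numerator_inj: "inj_on numerator W"
proof (rule inj_onI)
  fix u v assume uv: "u \<in> W" "v \<in> W" "numerator u = numerator v"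
  have "u ! j = v ! j" if "j < n" for j
    using that
  proof (induction j rule: less_induct)
    case (less j)
    have split: "(\<Oplus>m\<in>{..j}. lam (n - j + m) \<otimes> w ! m)
        = lam n \<otimes> w ! j \<oplus> (\<Oplus>m\<in>{..<j}. lam (n - j + m) \<otimes> w ! m)" if "w \<in> W" for w
    proof -
      have "{..j} = insert j {..<j}" by auto
      then have "(\<Oplus>m\<in>{..j}. lam (n - j + m) \<otimes> w ! m)
          = lam (n - j + j) \<otimes> w ! j \<oplus> (\<Oplus>m\<in>{..<j}. lam (n - j + m) \<otimes> w ! m)"
        using numerator_term_closed [OF that _ less.prems]
        by (simp only:) (rule R.finsum_insert, auto)
      then show ?thesis using less.prems by simp
    qed
    have closed: "(\<Oplus>m\<in>{..<j}. lam (n - j + m) \<otimes> u ! m) \<in> carrier R"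
      using numerator_term_closed [OF uv(1) _ less.prems] by (intro R.finsum_closed) auto
    have same: "(\<Oplus>m\<in>{..<j}. lam (n - j + m) \<otimes> u ! m) = (\<Oplus>m\<in>{..<j}. lam (n - j + m) \<otimes> v ! m)"
      using less.IH less.prems numerator_term_closed [OF uv(2) _ less.prems]
      by (intro R.finsum_cong') auto
    have "(\<Oplus>m\<in>{..j}. lam (n - j + m) \<otimes> u ! m) = (\<Oplus>m\<in>{..j}. lam (n - j + m) \<otimes> v ! m)"
      using coeff_numerator [OF uv(1), of j] coeff_numerator [OF uv(2), of j] uv(3) less.prems
      by (simp only: if_True)
    then have "lam n \<otimes> u ! j \<oplus> (\<Oplus>m\<in>{..<j}. lam (n - j + m) \<otimes> u ! m)
        = lam n \<otimes> v ! j \<oplus> (\<Oplus>m\<in>{..<j}. lam (n - j + m) \<otimes> u ! m)"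
      by (simp only: split [OF uv(1)] split [OF uv(2)] same)
    then have "lam n \<otimes> u ! j = lam n \<otimes> v ! j"
      using closed nth_closed [OF uv(1) less.prems] nth_closed [OF uv(2) less.prems]
      by (simp only: R.add.right_cancel R.m_closed lam_closed order_refl)
    then show "u ! j = v ! j"
      using lam_n_Unit nth_closed [OF uv(1) less.prems] nth_closed [OF uv(2) less.prems] by simp
  qed
  then show "u = v"
    using uv(1,2) by (intro nth_equalityI) (auto simp: words_def)
qed

lemma inj_on_proj_numerator: "inj_on (\<lambda>u. proj (numerator u)) W"
proof (rule inj_onI)
  fix u v assume uv: "u \<in> W" "v \<in> W" "proj (numerator u) = proj (numerator v)"
  then obtain q where q: "q \<in> carrier P" "numerator u \<ominus>\<^bsub>P\<^esub> numerator v = q \<otimes>\<^bsub>P\<^esub> \<Lambda>"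
    by (auto simp: proj_eq_iff mem_Lambda_ideal)
  have "coeff P (numerator u \<ominus>\<^bsub>P\<^esub> numerator v) j = \<zero>" if "n \<le> j" for j
    using uv(1,2) that by (simp add: coeff_numerator R.minus_eq)
  then have "q = \<zero>\<^bsub>P\<^esub>"
    using q by (intro multiple_of_Lambda_eq_zero) auto
  then have "numerator u = numerator v"
    using q uv(1,2) by simp
  then show "u = v" using uv(1,2) numerator_inj by (simp add: inj_on_def)
qed

text \<open>
  Remainders have \<open>n\<close> coefficients, so there are at most as many residues as words; this bound makes
  the injection of words into residues a bijection.
\<close>

lemma Q_subset_words: "carrier Q \<subseteq> (\<lambda>v. proj (trunc (\<lambda>j. v ! j))) ` W"
proof
  fix y assume "y \<in> carrier Q"
  then obtain p where "p \<in> carrier P" "y = proj p" by (auto simp: carrier_Q)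
  then obtain r where r: "r \<in> carrier P" "\<forall>j\<ge>n. coeff P r j = \<zero>" "y = proj r"
    using ex_remainder by metis
  define v where "v = map (coeff P r) [0..<n]"
  have v: "v \<in> W" using r(1) by (auto simp: words_def v_def)
  have "trunc (\<lambda>j. v ! j) = r"
  proof (rule up_eqI)
    show "trunc (\<lambda>j. v ! j) \<in> carrier P"
      using nth_closed [OF v] by (intro trunc_closed)
    show "coeff P (trunc (\<lambda>j. v ! j)) j = coeff P r j" for j
      using nth_closed [OF v] r(2) by (simp add: coeff_trunc) (simp add: v_def)
  qed (rule r(1))
  then show "y \<in> (\<lambda>v. proj (trunc (\<lambda>j. v ! j))) ` W"
    using v r(3) by blast
qed

lemma finite_Q: "finite (carrier Q)"
  by (rule finite_subset [OF Q_subset_words finite_imageI [OF finite_W]])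

lemma bij_betw_proj_numerator: "bij_betw (\<lambda>u. proj (numerator u)) W (carrier Q)"
proof -
  have "(\<lambda>u. proj (numerator u)) ` W = carrier Q"
  proof (rule card_seteq [OF finite_Q])
    show "(\<lambda>u. proj (numerator u)) ` W \<subseteq> carrier Q" by auto
    have "card (carrier Q) \<le> card W"
      by (rule surj_card_le [OF finite_W Q_subset_words])
    then show "card (carrier Q) \<le> card ((\<lambda>u. proj (numerator u)) ` W)"
      using card_image [OF inj_on_proj_numerator] by simp
  qed
  then show ?thesis using inj_on_proj_numerator by (simp add: bij_betw_def)
qed

section \<open>The succession rule as an affine map\<close>

text \<open>
  The new letter is the unique solution of a linear equation with the invertible coefficient
  \<open>lam n\<close>.
\<close>

lemma succession_rule_appends_solution:
  assumes u: "u \<in> W"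
  shows "\<exists>a \<in> carrier R. \<sigma> u = tl u @ [a] \<and> c = (\<Oplus>i\<in>{0..n}. lam i \<otimes> (u @ [a]) ! i)"
proof -
  obtain m where m: "n = Suc m" using n_pos by (cases n) auto
  have len: "length u = n" using u by (simp add: words_def)
  define S where "S = (\<Oplus>i\<in>{..m}. lam i \<otimes> u ! i)"
  have S: "S \<in> carrier R"
    unfolding S_def using nth_closed [OF u] m by (intro R.finsum_closed) auto
  have sum_eq: "(\<Oplus>i\<in>{0..n}. lam i \<otimes> (u @ [a]) ! i) = lam n \<otimes> a \<oplus> S" if "a \<in> carrier R" for a
  proof -
    have nth: "(u @ [a]) ! i \<in> carrier R" if "i \<le> n" for i
      using that \<open>a \<in> carrier R\<close> nth_closed [OF u, of i] len by (cases "i = n") (auto simp: nth_append)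
    have "(\<Oplus>i\<in>{0..n}. lam i \<otimes> (u @ [a]) ! i) = lam (Suc m) \<otimes> (u @ [a]) ! Suc m
        \<oplus> (\<Oplus>i\<in>{..m}. lam i \<otimes> (u @ [a]) ! i)"
      unfolding atLeast0AtMost m
      by (rule R.finsum_Suc) (use nth m in auto)
    also have "(\<Oplus>i\<in>{..m}. lam i \<otimes> (u @ [a]) ! i) = S"
      unfolding S_def using nth_closed [OF u] m len
      by (intro R.finsum_cong') (auto simp: nth_append)
    finally show ?thesis using len m by (simp add: nth_append)
  qed
  have rel: "u @ [a] \<in> affine_relation R n lam c \<longleftrightarrow> c = lam n \<otimes> a \<oplus> S"
    if "a \<in> carrier R" for a
    using u that by (simp add: affine_relation_def words_def flip: sum_eq [OF that])
  define a where "a = inv (lam n) \<otimes> (c \<ominus> S)"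
  have a: "a \<in> carrier R" using S lam_n_Unit by (simp add: a_def)
  have "lam n \<otimes> a = c \<ominus> S"
    using S lam_n_Unit by (simp add: a_def flip: R.m_assoc)
  then have sol: "c = lam n \<otimes> a \<oplus> S"
    using S by (simp add: R.minus_eq R.a_assoc R.l_neg)
  have "(THE a. a \<in> carrier R \<and> u @ [a] \<in> affine_relation R n lam c) = a"
  proof (rule the_equality)
    show "a \<in> carrier R \<and> u @ [a] \<in> affine_relation R n lam c"
      using a sol rel by blast
    fix a' assume "a' \<in> carrier R \<and> u @ [a'] \<in> affine_relation R n lam c"
    then have a': "a' \<in> carrier R" "c = lam n \<otimes> a' \<oplus> S" using rel by auto
    then have "lam n \<otimes> a' \<oplus> S = lam n \<otimes> a \<oplus> S" using sol by simp
    then have "lam n \<otimes> a' = lam n \<otimes> a" using a a'(1) S by simp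
    then show "a' = a" using lam_n_Unit a a'(1) by simp
  qed
  then show ?thesis
    using a sol sum_eq [OF a] by (auto simp: succession_rule_def)
qed

lemma \<sigma>_closed:
  assumes u: "u \<in> W"
  shows "\<sigma> u \<in> W"
proof -
  obtain a where "a \<in> carrier R" "\<sigma> u = tl u @ [a]"
    using succession_rule_appends_solution [OF u] by blast
  then show ?thesis
    using u n_pos by (cases u) (auto simp: words_def)
qed

text \<open>
  The effect of a shift on generating series: if \<open>A = a\<^sub>0 + X A'\<close>, then \<open>X \<Lambda> A' + a\<^sub>0 \<Lambda> = \<Lambda> A\<close>. In
  degrees below \<open>n\<close> this compares the sums defining the coefficients term by term; in degree \<open>n\<close> it
  is the recurrence that determines the new letter.
\<close>

lemma X_mult_numerator:
  assumes u: "u \<in> W"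
  shows "X_poly R \<otimes>\<^bsub>P\<^esub> numerator (\<sigma> u) \<oplus>\<^bsub>P\<^esub> monom P (u ! 0) 0 \<otimes>\<^bsub>P\<^esub> \<Lambda>
    = numerator u \<oplus>\<^bsub>P\<^esub> monom P c n"
proof (rule up_eqI)
  obtain a where a: "a \<in> carrier R" and \<sigma>u: "\<sigma> u = tl u @ [a]"
    and c_eq: "c = (\<Oplus>i\<in>{0..n}. lam i \<otimes> (u @ [a]) ! i)"
    using succession_rule_appends_solution [OF u] by blast
  have len: "length u = n" using u by (simp add: words_def)
  have u0: "u ! 0 \<in> carrier R" using nth_closed [OF u] n_pos by simp
  have ua: "(u @ [a]) ! i \<in> carrier R" if "i \<le> n" for i
    using that a nth_closed [OF u, of i] len by (cases "i = n") (auto simp: nth_append)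
  have nth_\<sigma>: "\<sigma> u ! i = (u @ [a]) ! Suc i" if "i < n" for i
    using that len n_pos unfolding \<sigma>u by (cases u) (auto simp: nth_append)
  have X: "X_poly R = monom P \<one> 1" by (simp add: X_poly_def P_def)
  have \<sigma>W: "\<sigma> u \<in> W" by (rule \<sigma>_closed [OF u])
  fix j
  have "coeff P (monom P (u ! 0) 0 \<otimes>\<^bsub>P\<^esub> \<Lambda>) j = u ! 0 \<otimes> coeff P \<Lambda> j"
    using u0 by (simp add: monom_mult_is_smult)
  moreover have "coeff P (X_poly R \<otimes>\<^bsub>P\<^esub> numerator (\<sigma> u)) j
      = (case j of 0 \<Rightarrow> \<zero> | Suc i \<Rightarrow> coeff P (numerator (\<sigma> u)) i)"
  proof (cases j)
    case 0
    then show ?thesis using \<sigma>W by (simp add: X)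
  next
    case (Suc i)
    then show ?thesis
      using coeff_monom_mult [of \<one> "numerator (\<sigma> u)" 1 i] \<sigma>W by (simp add: X)
  qed
  moreover have "(case j of 0 \<Rightarrow> \<zero> | Suc i \<Rightarrow> coeff P (numerator (\<sigma> u)) i) \<oplus> u ! 0 \<otimes> coeff P \<Lambda> j
      = coeff P (numerator u) j \<oplus> (if n = j then c else \<zero>)"
  proof (cases j)
    case 0
    then show ?thesis
      using u u0 n_pos by (simp add: coeff_Lambda coeff_numerator R.m_comm)
  next
    case (Suc i)
    have shift: "(\<Oplus>m\<in>{..Suc i}. lam (n - Suc i + m) \<otimes> (u @ [a]) ! m)
        = (\<Oplus>m\<in>{..i}. lam (n - i + m) \<otimes> \<sigma> u ! m) \<oplus> lam (n - Suc i) \<otimes> u ! 0" if "Suc i \<le> n"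
    proof -
      have "(\<Oplus>m\<in>{..Suc i}. lam (n - Suc i + m) \<otimes> (u @ [a]) ! m)
          = (\<Oplus>m\<in>{..i}. lam (n - Suc i + Suc m) \<otimes> (u @ [a]) ! Suc m) \<oplus> lam (n - Suc i + 0) \<otimes> (u @ [a]) ! 0"
        by (rule R.finsum_Suc2) (use that ua in auto)
      also have "(\<Oplus>m\<in>{..i}. lam (n - Suc i + Suc m) \<otimes> (u @ [a]) ! Suc m)
          = (\<Oplus>m\<in>{..i}. lam (n - i + m) \<otimes> \<sigma> u ! m)"
        using that nth_closed [OF \<sigma>W] by (intro R.finsum_cong') (auto simp: nth_\<sigma> Suc_diff_Suc)
      finally show ?thesis using len n_pos by (simp add: nth_append)
    qed
    have coeff_i: "(\<Oplus>m\<in>{..i}. lam (n - i + m) \<otimes> \<sigma> u ! m) \<in> carrier R" if "i < n"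
      by (rule numerator_coeff_closed [OF \<sigma>W that])
    consider "Suc i < n" | "Suc i = n" | "n < Suc i" by linarith
    then show ?thesis
    proof cases
      case 1
      have "(\<Oplus>m\<in>{..Suc i}. lam (n - Suc i + m) \<otimes> (u @ [a]) ! m)
          = (\<Oplus>m\<in>{..Suc i}. lam (n - Suc i + m) \<otimes> u ! m)"
        using 1 len nth_closed [OF u] by (intro R.finsum_cong') (auto simp: nth_append)
      moreover have "(\<Oplus>m\<in>{..Suc i}. lam (n - Suc i + m) \<otimes> u ! m) \<in> carrier R"
        using numerator_coeff_closed [OF u 1] .
      ultimately show ?thesis
        using 1 shift u0 u \<sigma>W
        by (simp add: Suc coeff_Lambda coeff_numerator R.m_comm del: R.finsum_Suc)
    next
      case 2
      have "c = (\<Oplus>m\<in>{..Suc i}. lam (n - Suc i + m) \<otimes> (u @ [a]) ! m)"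
        using c_eq 2 by (simp add: atLeast0AtMost del: R.finsum_Suc)
      moreover have "coeff P (numerator (\<sigma> u)) i = (\<Oplus>m\<in>{..i}. lam (n - i + m) \<otimes> \<sigma> u ! m)"
        using coeff_numerator [OF \<sigma>W, of i] 2 by auto
      ultimately have "coeff P (numerator (\<sigma> u)) i \<oplus> lam (n - Suc i) \<otimes> u ! 0 = c"
        using shift 2 by (simp only: order_refl)
      moreover have "coeff P \<Lambda> j = lam (n - Suc i)"
        using 2 by (simp add: Suc coeff_Lambda)
      moreover have "coeff P (numerator u) j = \<zero>"
        using 2 by (simp add: Suc coeff_numerator [OF u])
      moreover have "(case j of 0 \<Rightarrow> \<zero> | Suc i \<Rightarrow> coeff P (numerator (\<sigma> u)) i) = coeff P (numerator (\<sigma> u)) i"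
        by (simp add: Suc)
      moreover have "u ! 0 \<otimes> lam (n - Suc i) = lam (n - Suc i) \<otimes> u ! 0"
        using u0 by (simp add: R.m_comm)
      moreover have "n = j" using 2 Suc by simp
      ultimately show ?thesis
        by (simp only: simp_thms if_True R.l_zero c_closed)
    next
      case 3
      then show ?thesis
        using u u0 \<sigma>W by (simp add: Suc coeff_Lambda coeff_numerator)
    qed
  qed
  ultimately show "coeff P (X_poly R \<otimes>\<^bsub>P\<^esub> numerator (\<sigma> u) \<oplus>\<^bsub>P\<^esub> monom P (u ! 0) 0 \<otimes>\<^bsub>P\<^esub> \<Lambda>) j
      = coeff P (numerator u \<oplus>\<^bsub>P\<^esub> monom P c n) j"
    using u \<sigma>W u0 by simp
qed (use assms \<sigma>_closed nth_closed [OF assms, of 0] n_pos in auto)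

definition \<xi> :: "(nat \<Rightarrow> 'a) set" where "\<xi> = proj (X_poly R)"

definition \<epsilon> :: "(nat \<Rightarrow> 'a) set" where "\<epsilon> = proj (monom P c n)"

lemma \<xi>_closed [simp]: "\<xi> \<in> carrier Q" by (simp add: \<xi>_def)

lemma \<epsilon>_closed [simp]: "\<epsilon> \<in> carrier Q" by (simp add: \<epsilon>_def)

lemma proj_numerator_\<sigma>:
  assumes u: "u \<in> W"
  shows "\<xi> \<otimes>\<^bsub>Q\<^esub> proj (numerator (\<sigma> u)) = proj (numerator u) \<oplus>\<^bsub>Q\<^esub> \<epsilon>"
proof -
  have u0: "monom P (u ! 0) 0 \<in> carrier P" using nth_closed [OF u, of 0] n_pos by simp
  have \<sigma>W: "\<sigma> u \<in> W" by (rule \<sigma>_closed [OF u])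
  have "proj (X_poly R \<otimes>\<^bsub>P\<^esub> numerator (\<sigma> u) \<oplus>\<^bsub>P\<^esub> monom P (u ! 0) 0 \<otimes>\<^bsub>P\<^esub> \<Lambda>)
      = proj (numerator u \<oplus>\<^bsub>P\<^esub> monom P c n)"
    using X_mult_numerator [OF u] by simp
  then show ?thesis using u u0 \<sigma>W by (simp add: \<xi>_def \<epsilon>_def)
qed

text \<open>
  Every residue is of the form \<open>\<theta> u\<close>, hence also of the form \<open>\<theta> u + \<epsilon> = \<xi> \<theta> (\<sigma> u)\<close>; so \<open>\<xi>\<close> divides
  \<open>1\<close>.
\<close>

lemma \<xi>_Unit: "\<xi> \<in> Units Q"
proof -
  have "\<one>\<^bsub>Q\<^esub> \<ominus>\<^bsub>Q\<^esub> \<epsilon> \<in> (\<lambda>u. proj (numerator u)) ` W"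
    using bij_betw_proj_numerator by (simp add: bij_betw_def)
  then obtain u where u: "u \<in> W" "proj (numerator u) = \<one>\<^bsub>Q\<^esub> \<ominus>\<^bsub>Q\<^esub> \<epsilon>" by auto
  define y where "y = proj (numerator (\<sigma> u))"
  have y: "y \<in> carrier Q" using \<sigma>_closed [OF u(1)] by (simp add: y_def)
  have "\<xi> \<otimes>\<^bsub>Q\<^esub> y = \<one>\<^bsub>Q\<^esub>"
    using proj_numerator_\<sigma> [OF u(1)] by (simp add: u(2) y_def Q.minus_eq Q.a_assoc Q.l_neg)
  then show ?thesis
    unfolding Units_def using y Q.m_comm [OF y \<xi>_closed] by auto
qed

lemma \<xi>_pow_eq_one:
  assumes "order_X_mod R \<Lambda> dvd \<omega>"
  shows "\<xi> [^]\<^bsub>Q\<^esub> \<omega> = \<one>\<^bsub>Q\<^esub>"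
proof -
  interpret U: group "units_of Q" by (rule Q.units_group)
  have "order_X_mod R \<Lambda> = U.ord \<xi>"
    by (simp add: order_X_mod_def Let_def \<xi>_def proj_def Q_def Lambda_ideal_def P_def)
  then have "\<xi> [^]\<^bsub>units_of Q\<^esub> \<omega> = \<one>\<^bsub>units_of Q\<^esub>"
    using assms \<xi>_Unit by (subst U.pow_eq_id) (simp_all add: units_of_carrier)
  then show ?thesis
    using \<xi>_Unit by (simp add: Q.units_of_pow units_of_one)
qed

lemma affine_rotation:
  assumes "0 < \<omega>" "order_X_mod R \<Lambda> dvd \<omega>"
  shows "affine_rotation Q W \<sigma> (\<lambda>u. proj (numerator u)) \<xi> \<epsilon> \<omega>"
  using assms finite_Q \<xi>_pow_eq_one bij_betw_proj_numerator \<sigma>_closed proj_numerator_\<sigma>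
  by unfold_locales auto

section \<open>Quotients by the period ideals\<close>

abbreviation "\<delta> d \<equiv> \<xi> [^]\<^bsub>Q\<^esub> (d::nat) \<ominus>\<^bsub>Q\<^esub> \<one>\<^bsub>Q\<^esub>"

lemma proj_X_pow_minus_one: "proj (X_poly R [^]\<^bsub>P\<^esub> d \<ominus>\<^bsub>P\<^esub> \<one>\<^bsub>P\<^esub>) = \<delta> d" for d :: nat
  by (simp add: P.minus_eq Q.minus_eq \<xi>_def)

lemma period_ideal_ideal: "ideal (period_ideal R \<Lambda> d) P"
  unfolding period_ideal_def P_def [symmetric] by (rule P.genideal_ideal) simp

text \<open>
  The ideal \<open>(\<Lambda>, X\<^sup>d - 1)\<close> of \<open>P\<close> is the preimage of the principal ideal of \<open>Q\<close> generated by
  \<open>\<xi>\<^sup>d - 1\<close>, which turns questions about the former into questions about one element of a finite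
  ring.
\<close>

lemma mem_period_ideal_iff:
  assumes p: "p \<in> carrier P"
  shows "p \<in> period_ideal R \<Lambda> d \<longleftrightarrow> proj p \<in> PIdl\<^bsub>Q\<^esub> (\<delta> d)"
proof
  define J where "J = {p \<in> carrier P. proj p \<in> PIdl\<^bsub>Q\<^esub> (\<delta> d)}"
  have "ideal (PIdl\<^bsub>Q\<^esub> (\<delta> d)) Q" by (rule Q.cgenideal_ideal) simp
  moreover from this have "\<zero>\<^bsub>Q\<^esub> \<in> PIdl\<^bsub>Q\<^esub> (\<delta> d)"
    by (simp add: ideal.axioms(1) additive_subgroup.zero_closed)
  moreover have "\<delta> d \<in> PIdl\<^bsub>Q\<^esub> (\<delta> d)" by (rule Q.cgenideal_self) simp
  ultimately have "period_ideal R \<Lambda> d \<subseteq> J"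
    unfolding period_ideal_def P_def [symmetric]
    by (intro P.genideal_minimal) (auto simp: J_def proj_X_pow_minus_one proj.ring.ideal_vimage)
  then show "p \<in> period_ideal R \<Lambda> d \<Longrightarrow> proj p \<in> PIdl\<^bsub>Q\<^esub> (\<delta> d)" by (auto simp: J_def)
next
  assume "proj p \<in> PIdl\<^bsub>Q\<^esub> (\<delta> d)"
  then obtain r where r: "r \<in> carrier P" "proj p = proj r \<otimes>\<^bsub>Q\<^esub> \<delta> d"
    by (auto simp: cgenideal_def carrier_Q)
  define D where "D = X_poly R [^]\<^bsub>P\<^esub> d \<ominus>\<^bsub>P\<^esub> \<one>\<^bsub>P\<^esub>"
  have D: "D \<in> carrier P" by (simp add: D_def)
  have gens: "{\<Lambda>, D} \<subseteq> period_ideal R \<Lambda> d"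
    unfolding period_ideal_def P_def [symmetric] D_def by (rule P.genideal_self) simp
  have "proj p = proj (r \<otimes>\<^bsub>P\<^esub> D)"
    using r D proj_X_pow_minus_one [of d] by (simp add: D_def)
  then obtain q where q: "q \<in> carrier P" "p \<ominus>\<^bsub>P\<^esub> (r \<otimes>\<^bsub>P\<^esub> D) = q \<otimes>\<^bsub>P\<^esub> \<Lambda>"
    using proj_eq_iff [of p "r \<otimes>\<^bsub>P\<^esub> D"] p r(1) D by (auto simp: mem_Lambda_ideal)
  have "p = (p \<ominus>\<^bsub>P\<^esub> (r \<otimes>\<^bsub>P\<^esub> D)) \<oplus>\<^bsub>P\<^esub> r \<otimes>\<^bsub>P\<^esub> D"
    using p P.m_closed [OF r(1) D] by (simp add: P.minus_eq P.a_assoc P.l_neg)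
  then have "p = q \<otimes>\<^bsub>P\<^esub> \<Lambda> \<oplus>\<^bsub>P\<^esub> r \<otimes>\<^bsub>P\<^esub> D" by (simp only: q(2))
  then show "p \<in> period_ideal R \<Lambda> d"
    using gens q(1) r(1) period_ideal_ideal
    by (simp add: ideal.I_l_closed additive_subgroup.a_closed ideal.axioms(1))
qed

text \<open>
  Cosets of the period ideal correspond to cosets of the ideal generated by \<open>\<xi>\<^sup>d - 1\<close> in \<open>Q\<close>, and these
  are as many as the elements that \<open>\<xi>\<^sup>d - 1\<close> annihilates.
\<close>

lemma card_quotient_period_ideal:
  "card (carrier (P Quot period_ideal R \<Lambda> d)) = card {q \<in> carrier Q. \<xi> [^]\<^bsub>Q\<^esub> d \<otimes>\<^bsub>Q\<^esub> q = q}"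
proof -
  have \<delta>: "\<delta> d \<in> carrier Q" by simp
  have "card (carrier (P Quot period_ideal R \<Lambda> d))
      = card ((\<lambda>p. period_ideal R \<Lambda> d +>\<^bsub>P\<^esub> p) ` carrier P)"
    by (simp add: carrier_quotient)
  also have "\<dots> = card ((\<lambda>p. PIdl\<^bsub>Q\<^esub> (\<delta> d) +>\<^bsub>Q\<^esub> proj p) ` carrier P)"
  proof (rule card_image_eqI)
    fix p q assume pq: "p \<in> carrier P" "q \<in> carrier P"
    have "proj (p \<ominus>\<^bsub>P\<^esub> q) = proj p \<ominus>\<^bsub>Q\<^esub> proj q"
      using pq by (simp add: P.minus_eq Q.minus_eq)
    then show "period_ideal R \<Lambda> d +>\<^bsub>P\<^esub> p = period_ideal R \<Lambda> d +>\<^bsub>P\<^esub> q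
      \<longleftrightarrow> PIdl\<^bsub>Q\<^esub> (\<delta> d) +>\<^bsub>Q\<^esub> proj p = PIdl\<^bsub>Q\<^esub> (\<delta> d) +>\<^bsub>Q\<^esub> proj q"
      using P.quotient_eq_iff_same_a_r_cos [OF period_ideal_ideal pq, of d]
        Q.quotient_eq_iff_same_a_r_cos [OF Q.cgenideal_ideal [OF \<delta>], of "proj p" "proj q"]
        mem_period_ideal_iff [of "p \<ominus>\<^bsub>P\<^esub> q" d] pq by simp
  qed
  also have "\<dots> = card (carrier (Q Quot (PIdl\<^bsub>Q\<^esub> (\<delta> d))))"
    by (simp add: carrier_quotient carrier_Q image_image)
  also have "\<dots> = card {q \<in> carrier Q. \<delta> d \<otimes>\<^bsub>Q\<^esub> q = \<zero>\<^bsub>Q\<^esub>}"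
    by (rule Q.card_quotient_principal_ideal [OF finite_Q \<delta>])
  also have "{q \<in> carrier Q. \<delta> d \<otimes>\<^bsub>Q\<^esub> q = \<zero>\<^bsub>Q\<^esub>} = {q \<in> carrier Q. \<xi> [^]\<^bsub>Q\<^esub> d \<otimes>\<^bsub>Q\<^esub> q = q}"
  proof (rule Collect_cong, rule conj_cong [OF refl])
    fix q assume "q \<in> carrier Q"
    then have "\<delta> d \<otimes>\<^bsub>Q\<^esub> q = \<xi> [^]\<^bsub>Q\<^esub> d \<otimes>\<^bsub>Q\<^esub> q \<ominus>\<^bsub>Q\<^esub> q"
      by (simp add: Q.minus_eq Q.l_distr Q.l_minus)
    then show "\<delta> d \<otimes>\<^bsub>Q\<^esub> q = \<zero>\<^bsub>Q\<^esub> \<longleftrightarrow> \<xi> [^]\<^bsub>Q\<^esub> d \<otimes>\<^bsub>Q\<^esub> q = q"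
      using \<open>q \<in> carrier Q\<close> by simp
  qed
  finally show ?thesis .
qed

text \<open>
  The element \<open>\<epsilon>\<close> is the class of \<open>c X\<^sup>n\<close>, not of \<open>c\<close>, but the two differ by the unit \<open>\<xi>\<^sup>n\<close>, which
  does not affect membership in an ideal.
\<close>

lemma geometric_poly_mem_period_ideal_iff:
  "geometric_poly R c t \<in> period_ideal R \<Lambda> t
   \<longleftrightarrow> (\<exists>r \<in> carrier Q. \<epsilon> \<otimes>\<^bsub>Q\<^esub> (\<Oplus>\<^bsub>Q\<^esub>j\<in>{..<t}. \<xi> [^]\<^bsub>Q\<^esub> j) = \<delta> t \<otimes>\<^bsub>Q\<^esub> r)"
proof -
  define g where "g = (\<Oplus>\<^bsub>Q\<^esub>j\<in>{..<t}. \<xi> [^]\<^bsub>Q\<^esub> j)"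
  define c0 where "c0 = proj (monom P c 0)"
  have closed [simp]: "g \<in> carrier Q" "c0 \<in> carrier Q" "\<delta> t \<in> carrier Q"
    by (simp_all add: g_def c0_def)
  have geo: "geometric_poly R c t = monom P c 0 \<otimes>\<^bsub>P\<^esub> (\<Oplus>\<^bsub>P\<^esub>j\<in>{..<t}. X_poly R [^]\<^bsub>P\<^esub> j)"
    by (simp add: geometric_poly_def P_def [symmetric] monom_mult_is_smult)
  have "proj (\<Oplus>\<^bsub>P\<^esub>j\<in>{..<t}. X_poly R [^]\<^bsub>P\<^esub> j) = g"
    unfolding g_def by (subst proj.hom_finsum) (auto simp: \<xi>_def comp_def intro!: Q.finsum_cong')
  then have proj_geo: "proj (geometric_poly R c t) = c0 \<otimes>\<^bsub>Q\<^esub> g"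
    by (simp add: geo c0_def)
  have "monom P c n = monom P c 0 \<otimes>\<^bsub>P\<^esub> X_poly R [^]\<^bsub>P\<^esub> n"
    using monom_mult [of c \<one> 0 n] monom_pow [of \<one> 1 n] by (simp add: X_poly_def P_def [symmetric])
  then have \<epsilon>_eq: "\<epsilon> = \<xi> [^]\<^bsub>Q\<^esub> n \<otimes>\<^bsub>Q\<^esub> c0"
    by (simp add: \<epsilon>_def \<xi>_def c0_def Q.m_comm)
  have pow_Unit: "\<xi> [^]\<^bsub>Q\<^esub> n \<in> Units Q" by (rule Q.Units_pow_closed [OF \<xi>_Unit])
  define z where "z = inv\<^bsub>Q\<^esub> (\<xi> [^]\<^bsub>Q\<^esub> n)"
  have z: "z \<in> carrier Q" "z \<otimes>\<^bsub>Q\<^esub> \<xi> [^]\<^bsub>Q\<^esub> n = \<one>\<^bsub>Q\<^esub>"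
    using pow_Unit by (simp_all add: z_def)
  have "geometric_poly R c t \<in> period_ideal R \<Lambda> t \<longleftrightarrow> c0 \<otimes>\<^bsub>Q\<^esub> g \<in> PIdl\<^bsub>Q\<^esub> (\<delta> t)"
    using mem_period_ideal_iff [of "geometric_poly R c t" t] by (simp add: proj_geo) (simp add: geo)
  also have "\<dots> \<longleftrightarrow> \<epsilon> \<otimes>\<^bsub>Q\<^esub> g \<in> PIdl\<^bsub>Q\<^esub> (\<delta> t)"
  proof
    assume "c0 \<otimes>\<^bsub>Q\<^esub> g \<in> PIdl\<^bsub>Q\<^esub> (\<delta> t)"
    then have "\<xi> [^]\<^bsub>Q\<^esub> n \<otimes>\<^bsub>Q\<^esub> (c0 \<otimes>\<^bsub>Q\<^esub> g) \<in> PIdl\<^bsub>Q\<^esub> (\<delta> t)"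
      by (rule ideal.I_l_closed [OF Q.cgenideal_ideal [OF closed(3)]]) simp
    then show "\<epsilon> \<otimes>\<^bsub>Q\<^esub> g \<in> PIdl\<^bsub>Q\<^esub> (\<delta> t)" by (simp add: \<epsilon>_eq Q.m_assoc)
  next
    assume "\<epsilon> \<otimes>\<^bsub>Q\<^esub> g \<in> PIdl\<^bsub>Q\<^esub> (\<delta> t)"
    then have "z \<otimes>\<^bsub>Q\<^esub> (\<epsilon> \<otimes>\<^bsub>Q\<^esub> g) \<in> PIdl\<^bsub>Q\<^esub> (\<delta> t)"
      using z(1) by (rule ideal.I_l_closed [OF Q.cgenideal_ideal [OF closed(3)]])
    moreover have "z \<otimes>\<^bsub>Q\<^esub> (\<epsilon> \<otimes>\<^bsub>Q\<^esub> g) = (z \<otimes>\<^bsub>Q\<^esub> \<xi> [^]\<^bsub>Q\<^esub> n) \<otimes>\<^bsub>Q\<^esub> (c0 \<otimes>\<^bsub>Q\<^esub> g)"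
      using z(1) by (simp add: \<epsilon>_eq Q.m_assoc)
    ultimately show "c0 \<otimes>\<^bsub>Q\<^esub> g \<in> PIdl\<^bsub>Q\<^esub> (\<delta> t)" by (simp add: z(2))
  qed
  also have "\<dots> \<longleftrightarrow> (\<exists>r \<in> carrier Q. \<epsilon> \<otimes>\<^bsub>Q\<^esub> g = \<delta> t \<otimes>\<^bsub>Q\<^esub> r)"
    using Q.m_comm closed(3) by (auto simp: cgenideal_def)
  finally show ?thesis by (simp only: g_def)
qed

end

section \<open>The number of cycles\<close>

lemma finite_carrier_ZFact:
  assumes "0 < m"
  shows "finite (carrier (ZFact m))"
proof -
  have "carrier (ZFact m) = range (ZMod m)"
    by (simp add: ZFact_def carrier_quotient ZMod_def)
  also have "\<dots> = ZMod m ` {0..<m}"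
  proof (intro equalityI subsetI)
    fix z assume "z \<in> range (ZMod m)"
    then obtain a where "z = ZMod m (a mod m)" using ZMod_mod by blast
    then show "z \<in> ZMod m ` {0..<m}" using assms by auto
  qed auto
  finally show ?thesis by simp
qed

theorem theorem2:
  fixes b n k \<omega> s :: nat
    and c :: "int set"
    and lam :: "nat \<Rightarrow> int set"
  defines "\<Gamma> \<equiv> ZFact (int b)"
  defines "\<sigma> \<equiv> succession_rule (carrier \<Gamma>) (affine_relation \<Gamma> n lam c)"
  defines "F \<equiv> factor (words (carrier \<Gamma>) n) k \<sigma>"
  defines "\<Lambda> \<equiv> Lambda_poly \<Gamma> n lam"
  assumes "b \<ge> 1" and "n \<ge> 1" and "k \<ge> 1"
    and "c \<in> carrier \<Gamma>"
    and "\<And>i. i \<le> n \<Longrightarrow> lam i \<in> carrier \<Gamma>"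
    and "lam 0 \<in> Units \<Gamma>" and "lam n \<in> Units \<Gamma>"
    and "\<omega> > 0" and "order_X_mod \<Gamma> \<Lambda> dvd \<omega>"
    and "s = Min (card ` F)"
  shows "(s > 0 \<and> k dvd s \<and> geometric_poly \<Gamma> c s \<in> period_ideal \<Gamma> \<Lambda> s \<and>
          (\<forall>t. t > 0 \<and> k dvd t \<and> geometric_poly \<Gamma> c t \<in> period_ideal \<Gamma> \<Lambda> t \<longrightarrow> s \<le> t))
       \<and> real (card F) =
           (real k * real (gcd s \<omega>)) / (real s * real \<omega>) *
           (\<Sum>d | d > 0 \<and> gcd s \<omega> dvd d \<and> d dvd \<omega>.
              real (totient (\<omega> div d)) * real (card (carrier (UP \<Gamma> Quot period_ideal \<Gamma> \<Lambda> d))))"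
proof -
  have cring: "cring \<Gamma>" unfolding \<Gamma>_def by (rule ZFact_is_cring)
  have finite: "finite (carrier \<Gamma>)"
    unfolding \<Gamma>_def using assms(5) by (intro finite_carrier_ZFact) simp
  interpret linear_recurrence \<Gamma> "UP \<Gamma>" n lam c
    by (intro linear_recurrence.intro UP_cring.intro linear_recurrence_axioms.intro cring finite assms)
  interpret rot: affine_rotation Q "words (carrier \<Gamma>) n" \<sigma> "\<lambda>u. proj (numerator u)" \<xi> \<epsilon> \<omega>
    unfolding \<sigma>_def using assms(12,13) by (intro affine_rotation) (simp_all add: \<Lambda>_def)
  have "0 < k" using assms(7) by simp
  have min: "s = Min (card ` factor (words (carrier \<Gamma>) n) k \<sigma>)"
    using assms(14) by (simp add: F_def)
  note count = rot.card_factor [OF \<open>0 < k\<close> min]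
  have admissible_iff: "rot.admissible t \<longleftrightarrow> geometric_poly \<Gamma> c t \<in> period_ideal \<Gamma> \<Lambda> t" for t
    by (simp add: rot.admissible_def rot.geom_def \<Lambda>_def geometric_poly_mem_period_ideal_iff)
  have invariants_eq: "card (rot.invariants d) = card (carrier (UP \<Gamma> Quot period_ideal \<Gamma> \<Lambda> d))" for d
    by (simp add: rot.invariants_def \<Lambda>_def card_quotient_period_ideal)
  define S where "S = (\<Sum>d | d > 0 \<and> gcd s \<omega> dvd d \<and> d dvd \<omega>.
    totient (\<omega> div d) * card (carrier (UP \<Gamma> Quot period_ideal \<Gamma> \<Lambda> d)))"
  have "s * \<omega> * card F = k * gcd s \<omega> * S"
    using count(5) by (simp add: S_def F_def invariants_eq)
  then have "real s * real \<omega> * real (card F) = real k * real (gcd s \<omega>) * real S"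
    by (metis of_nat_mult)
  then have "real (card F) = (real k * real (gcd s \<omega>)) / (real s * real \<omega>) * real S"
    using count(1) assms(12) by (simp add: field_simps)
  then show ?thesis
    using count(1-4) by (simp add: admissible_iff S_def)
qed

end
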